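(* Let $f,h_1,\dots,h_p\colon\mathbb R^n\times\mathbb R^m\to\mathbb R$ be continuously differentiable, $I=\{1,\dots,\ell\}$, $J=\{\ell+1,\dots,p\}$, $\Gamma(x):=\{y\mid h_i(x,y)\le0\ (i\in I),\ h_i(x,y)=0\ (i\in J)\}$, $\varphi(x):=\inf\{f(x,y)\mid y\in\Gamma(x)\}$, $S(x):=\operatorname{argmin}\{f(x,y)\mid y\in\Gamma(x)\}$ and $h_0(x,y):=f(x,y)-\varphi(x)$, so that $S(x)=\{y\mid h_i(x,y)\le0\ (i\in I\cup\{0\}),\ h_i(x,y)=0\ (i\in J)\}$. Fix $\bar x\in\operatorname{dom}\Gamma$. (a) Assume (A1'): for each $x$, $f(x,\cdot)$ and $h_i(x,\cdot)$, $i\in I$, are convex and $h_i(x,\cdot)$, $i\in J$, are affine; (A2): $\Gamma$ is locally bounded at $\bar x$; RCPLD$_S$ holds at each point of $\{\bar x\}\times S(\bar x)$; and $\varphi$ is continuous at $\bar x$. Then $S$ is R-regular at each point of $\{\bar x\}\times S(\bar x)$, and $S$ has the Aubin property at all these points. (b) Let $\bar y\in S(\bar x)$ be such that $S$ is inner semicontinuous at $(\bar x,\bar y)$ and RCPLD$_S$ holds at $(\bar x,\bar y)$. Then $S$ is R-regular at $(\bar x,\bar y)$ and has the Aubin property at this point.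
   Context: $\operatorname{dom}\Gamma:=\{x\mid\Gamma(x)\neq\emptyset\}$; $\inf\emptyset=+\infty$ (so $h_0=-\infty$ off $\operatorname{dom}\Gamma$); $\operatorname{dist}(y,A):=\inf_{z\in A}\|z-y\|$, $=+\infty$ for $A=\emptyset$; $\mathbb B$ is the closed Euclidean unit ball. $\Gamma$ is locally bounded at $\bar x$ if there are a bounded $B$ and a neighborhood $V$ of $\bar x$ with $\Gamma(x)\subset B$ for $x\in V$. $S$ is R-regular at $(\bar x,\bar y)\in\operatorname{gph}S$ if there exist $\kappa>0$ and a neighborhood $U$ of $(\bar x,\bar y)$ with $\operatorname{dist}(y,S(x))\le\kappa\max\{0,\max_{i\in I\cup\{0\}}h_i(x,y),\max_{i\in J}|h_i(x,y)|\}$ for all $(x,y)\in U$. $S$ has the Aubin property at $(\bar x,\bar y)$ if there are neighborhoods $V,W$ of $\bar x,\bar y$ and $\kappa>0$ with $S(x)\cap W\subset S(x')+\kappa\|x-x'\|\mathbb B$ for all $x,x'\in V$. $S$ is inner semicontinuous at $(\bar x,\bar y)$ if for every $x^k\to\bar x$ there is $y^k\to\bar y$ with $y^k\in S(x^k)$ for large $k$. A pair of finite families $((a^i)_{i\in I_1},(b^i)_{i\in I_2})$ is positive-linearly dependent if there are $\alpha_i\ge0$, $\beta_i$, not all zero, with $\sum\alpha_ia^i+\sum\beta_ib^i=0$. For $(\bar x,\bar y)\in\operatorname{gph}S$ put $I(\bar x,\bar y):=\{i\in I\mid h_i(\bar x,\bar y)=0\}$ and $\nabla_yh_0:=\nabla_yf$.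 RCPLD$_S$ holds at $(\bar x,\bar y)$ if there are a neighborhood $U$ of $(\bar x,\bar y)$ and $\mathcal S\subset J$ such that: (i) $\{\nabla_yh_i(\bar x,\bar y)\mid i\in\mathcal S\}$ is a basis of the span of $\{\nabla_yh_i(\bar x,\bar y)\mid i\in J\}$; (ii) $(\nabla_yh_i(x,y))_{i\in J}$ has constant rank on $U$; (iii) for each $K\subset\{0\}\cup I(\bar x,\bar y)$ with $((\nabla_yh_i(\bar x,\bar y))_{i\in K},(\nabla_yh_i(\bar x,\bar y))_{i\in\mathcal S})$ positive-linearly dependent, $(\nabla_yh_i(x,y))_{i\in K\cup\mathcal S}$ is linearly dependent for each $(x,y)\in U$. *)

theory Defs
  imports "HOL-Analysis.Analysis" "HOL-Library.Extended_Real"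
begin

definition C1_fun :: "('a::euclidean_space \<Rightarrow> real) \<Rightarrow> bool" where
  "C1_fun g \<longleftrightarrow> (\<exists>g'. (\<forall>z. (g has_derivative blinfun_apply (g' z)) (at z))
                      \<and> continuous_on UNIV g')"

definition grad_y :: "('a::euclidean_space \<times> 'b::euclidean_space \<Rightarrow> real) \<Rightarrow> 'a \<times> 'b \<Rightarrow> 'b" where
  "grad_y g z = (\<Sum>b\<in>Basis. frechet_derivative g (at z) (0, b) *\<^sub>R b)"

definition affine_fun :: "('b::euclidean_space \<Rightarrow> real) \<Rightarrow> bool" where
  "affine_fun g \<longleftrightarrow> (\<exists>a c. \<forall>y. g y = inner a y + c)"

definition Gam :: "(nat \<Rightarrow> 'a \<times> 'b \<Rightarrow> real) \<Rightarrow> nat \<Rightarrow> nat \<Rightarrow> 'a \<Rightarrow> 'b set" where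
  "Gam h l p x = {y. (\<forall>i\<in>{1..l}. h i (x, y) \<le> 0) \<and> (\<forall>i\<in>{l+1..p}. h i (x, y) = 0)}"

text \<open>Optimal value function (extended-real valued; inf of the empty set is +infinity).\<close>
definition phi :: "('a \<times> 'b \<Rightarrow> real) \<Rightarrow> (nat \<Rightarrow> 'a \<times> 'b \<Rightarrow> real) \<Rightarrow> nat \<Rightarrow> nat \<Rightarrow> 'a \<Rightarrow> ereal" where
  "phi f h l p x = (INF y\<in>Gam h l p x. ereal (f (x, y)))"

definition Sol :: "('a \<times> 'b \<Rightarrow> real) \<Rightarrow> (nat \<Rightarrow> 'a \<times> 'b \<Rightarrow> real) \<Rightarrow> nat \<Rightarrow> nat \<Rightarrow> 'a \<Rightarrow> 'b set" where
  "Sol f h l p x = {y \<in> Gam h l p x. \<forall>y'\<in>Gam h l p x. f (x, y) \<le> f (x, y')}"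

definition h0 :: "('a \<times> 'b \<Rightarrow> real) \<Rightarrow> (nat \<Rightarrow> 'a \<times> 'b \<Rightarrow> real) \<Rightarrow> nat \<Rightarrow> nat \<Rightarrow> 'a \<times> 'b \<Rightarrow> ereal" where
  "h0 f h l p z = ereal (f z) - phi f h l p (fst z)"

definition edist_set :: "'b::metric_space \<Rightarrow> 'b set \<Rightarrow> ereal" where
  "edist_set y A = (if A = {} then \<infinity> else ereal (infdist y A))"

definition residual :: "('a \<times> 'b \<Rightarrow> real) \<Rightarrow> (nat \<Rightarrow> 'a \<times> 'b \<Rightarrow> real) \<Rightarrow> nat \<Rightarrow> nat \<Rightarrow> 'a \<times> 'b \<Rightarrow> ereal" where
  "residual f h l p z = Max ({0, h0 f h l p z} \<union> (\<lambda>i. ereal (h i z)) ` {1..l}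
                                \<union> (\<lambda>i. ereal \<bar>h i z\<bar>) ` {l+1..p})"

definition R_regular_S :: "('a::euclidean_space \<times> 'b::euclidean_space \<Rightarrow> real) \<Rightarrow> (nat \<Rightarrow> 'a \<times> 'b \<Rightarrow> real)
    \<Rightarrow> nat \<Rightarrow> nat \<Rightarrow> 'a \<Rightarrow> 'b \<Rightarrow> bool" where
  "R_regular_S f h l p xb yb \<longleftrightarrow>
     (\<exists>\<kappa>>0. \<exists>U. open U \<and> (xb, yb) \<in> U \<and>
        (\<forall>x y. (x, y) \<in> U \<longrightarrow> edist_set y (Sol f h l p x) \<le> ereal \<kappa> * residual f h l p (x, y)))"

definition aubin :: "('a::real_normed_vector \<Rightarrow> 'b::real_normed_vector set) \<Rightarrow> 'a \<Rightarrow> 'b \<Rightarrow> bool" where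
  "aubin F xb yb \<longleftrightarrow>
     (\<exists>V W \<kappa>. open V \<and> xb \<in> V \<and> open W \<and> yb \<in> W \<and> \<kappa> > 0 \<and>
        (\<forall>x\<in>V. \<forall>x'\<in>V. \<forall>y \<in> F x \<inter> W. \<exists>z\<in>F x'. norm (y - z) \<le> \<kappa> * norm (x - x')))"

definition inner_semicont :: "('a::topological_space \<Rightarrow> 'b::topological_space set) \<Rightarrow> 'a \<Rightarrow> 'b \<Rightarrow> bool" where
  "inner_semicont F xb yb \<longleftrightarrow>
     (\<forall>xk. xk \<longlonglongrightarrow> xb \<longrightarrow> (\<exists>yk. yk \<longlonglongrightarrow> yb \<and> (\<forall>\<^sub>F k in sequentially. yk k \<in> F (xk k))))"

definition locally_bounded :: "('a::topological_space \<Rightarrow> 'b::metric_space set) \<Rightarrow> 'a \<Rightarrow> bool" where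
  "locally_bounded F xb \<longleftrightarrow> (\<exists>B V. bounded B \<and> open V \<and> xb \<in> V \<and> (\<forall>x\<in>V. F x \<subseteq> B))"

definition lin_dep_fam :: "(nat \<Rightarrow> 'b::real_vector) \<Rightarrow> nat set \<Rightarrow> bool" where
  "lin_dep_fam v K \<longleftrightarrow> (\<exists>c. (\<exists>i\<in>K. c i \<noteq> 0) \<and> (\<Sum>i\<in>K. c i *\<^sub>R v i) = 0)"

definition pos_lin_dep :: "(nat \<Rightarrow> 'b::real_vector) \<Rightarrow> nat set \<Rightarrow> (nat \<Rightarrow> 'b) \<Rightarrow> nat set \<Rightarrow> bool" where
  "pos_lin_dep a K1 b K2 \<longleftrightarrow>
     (\<exists>\<alpha> \<beta>. (\<forall>i\<in>K1. \<alpha> i \<ge> 0) \<and> ((\<exists>i\<in>K1. \<alpha> i \<noteq> 0) \<or> (\<exists>i\<in>K2. \<beta> i \<noteq> 0)) \<and>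
            (\<Sum>i\<in>K1. \<alpha> i *\<^sub>R a i) + (\<Sum>i\<in>K2. \<beta> i *\<^sub>R b i) = 0)"

text \<open>Partial gradients in y of h_i, with the convention grad_y h_0 := grad_y f.\<close>
definition gy :: "('a::euclidean_space \<times> 'b::euclidean_space \<Rightarrow> real) \<Rightarrow> (nat \<Rightarrow> 'a \<times> 'b \<Rightarrow> real)
    \<Rightarrow> nat \<Rightarrow> 'a \<times> 'b \<Rightarrow> 'b" where
  "gy f h i z = (if i = 0 then grad_y f z else grad_y (h i) z)"

definition RCPLD_S :: "('a::euclidean_space \<times> 'b::euclidean_space \<Rightarrow> real) \<Rightarrow> (nat \<Rightarrow> 'a \<times> 'b \<Rightarrow> real)
    \<Rightarrow> nat \<Rightarrow> nat \<Rightarrow> 'a \<Rightarrow> 'b \<Rightarrow> bool" where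
  "RCPLD_S f h l p xb yb \<longleftrightarrow>
     (\<exists>U \<S>. open U \<and> (xb, yb) \<in> U \<and> \<S> \<subseteq> {l+1..p} \<and>
        \<comment> \<open>(i) basis of the span of the equality gradients at the reference point\<close>
        \<not> lin_dep_fam (\<lambda>i. gy f h i (xb, yb)) \<S> \<and>
        span ((\<lambda>i. gy f h i (xb, yb)) ` \<S>) = span ((\<lambda>i. gy f h i (xb, yb)) ` {l+1..p}) \<and>
        \<comment> \<open>(ii) constant rank on U\<close>
        (\<forall>z\<in>U. \<forall>z'\<in>U. dim ((\<lambda>i. gy f h i z) ` {l+1..p}) = dim ((\<lambda>i. gy f h i z') ` {l+1..p})) \<and>
        \<comment> \<open>(iii)\<close>
        (\<forall>K. K \<subseteq> {0} \<union> {i\<in>{1..l}. h i (xb, yb) = 0} \<longrightarrow>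
             pos_lin_dep (\<lambda>i. gy f h i (xb, yb)) K (\<lambda>i. gy f h i (xb, yb)) \<S> \<longrightarrow>
             (\<forall>z\<in>U. lin_dep_fam (\<lambda>i. gy f h i z) (K \<union> \<S>))))"

end

(*
Let z be a projection of y onto S(x). Quadratic penalisation yields points w near z at which
(y - w) + (z - w) is a combination of the y-gradients, with nonnegative weights only on violated
inequalities. RCPLD lets one pass, by a Caratheodory reduction modulo the equality gradients
indexed by a basis, to coefficients bounded by M times the norm of this vector, uniformly near the
reference point: a reduced index set K is linearly independent at a nearby point, hence not
positive-linearly dependent at the reference point. Taking the inner product with y - w and letting
w tend to z gives |y - z| <= M (r + eps |y - z|), where r is the residual and eps the relative
linearisation error. Inner semicontinuity keeps z near the reference point, so M eps <= 1/2 can be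
arranged and R-regularity follows.

For the Aubin property the residual must be Lipschitz in x, i.e. phi must be. The index sets not
containing 0 give RCPLD for Gamma, hence the Aubin property of Gamma, hence a local Lipschitz bound
for phi.

In the convex case eps = 0, so no smallness of |y - z| is needed; projecting a fixed solution onto
S(x_k) and using multipliers bounded near a cluster point of the projections yields inner
semicontinuity, which reduces (a) to (b).
*)

theory Submission
  imports Defs
begin

text \<open>No limit of multipliers is therefore taken: they are eliminated at w, what remains is an
  inequality in w alone describing a closed set, and only this inequality passes to the limit. The
  value function enters as a right-hand side that depends on x only. It drops out of y-gradients and
  of increments in y, so the error bound for S can be proved before phi is known to be Lipschitz;
  this breaks the apparent circle, because the Lipschitz bound for phi comes from Gamma, whose
  right-hand sides are zero. One abstract system with a free right-hand side is instantiated for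
  both maps. The central estimate asks only that the projection be near the reference point and
  takes the linearisation error as a hypothesis. It thus serves the smooth case (y near, small
  error) and the convex case (projection far from y, zero error).\<close>

section \<open>Bounded multipliers under RCPLD\<close>

text \<open>By compactness the norm has a positive minimum over the admissible coefficients of
  l1-norm 1; positive homogeneity extends the bound to all admissible coefficients.\<close>

lemma coeff_norm_lower_bound:
  fixes v :: "nat \<Rightarrow> 'b::real_normed_vector"
  assumes fin: "finite T" and "K \<subseteq> T"
    and npos: "\<And>a. (\<forall>i\<in>K. 0 \<le> a i) \<Longrightarrow> (\<Sum>i\<in>T. a i *\<^sub>R v i) = 0 \<Longrightarrow> \<forall>i\<in>T. a i = 0"
  obtains c where "c > 0"
    "\<And>a. (\<forall>i\<in>K. 0 \<le> a i) \<Longrightarrow> c * (\<Sum>i\<in>T. \<bar>a i\<bar>) \<le> norm (\<Sum>i\<in>T. a i *\<^sub>R v i)"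
proof -
  \<comment> \<open>Coefficients are functions on all of \<open>nat\<close>; pinning them to 0 off
    \<open>T\<close> makes the box compact by Tychonoff.\<close>
  let ?B = "PiE UNIV (\<lambda>i::nat. if i \<in> T then {-1..1::real} else {0})"
  define D where "D = ?B \<inter> ({a. \<forall>i\<in>K. 0 \<le> a i} \<inter> {a. (\<Sum>i\<in>T. \<bar>a i\<bar>) = 1})"
  let ?N = "\<lambda>a. norm (\<Sum>i\<in>T. a i *\<^sub>R v i)"
  have "compactin (product_topology (\<lambda>i. euclidean) UNIV) ?B"
    by (subst compactin_PiE) auto
  then have cB: "compact ?B"
    by (simp add: euclidean_product_topology)
  have "closed (\<Inter>i\<in>K. {a::nat\<Rightarrow>real. 0 \<le> a i})"
    by (intro closed_INT ballI closed_Collect_le continuous_on_const continuous_on_product_coordinates)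
  moreover have "(\<Inter>i\<in>K. {a::nat\<Rightarrow>real. 0 \<le> a i}) = {a. \<forall>i\<in>K. 0 \<le> a i}"
    by auto
  moreover have "closed {a::nat\<Rightarrow>real. (\<Sum>i\<in>T. \<bar>a i\<bar>) = 1}"
    by (intro closed_Collect_eq continuous_on_const continuous_on_sum continuous_on_rabs
        continuous_on_product_coordinates)
  ultimately have cD: "compact D"
    using cB unfolding D_def by (intro compact_Int_closed closed_Int) auto
  have contN: "continuous_on D ?N"
    by (intro continuous_on_norm continuous_on_sum continuous_on_scaleR continuous_on_const
        continuous_on_subset[OF continuous_on_product_coordinates] subset_UNIV)
  obtain c where c: "c > 0" "\<And>a. a \<in> D \<Longrightarrow> c \<le> ?N a"
  proof (cases "D = {}")
    case True
    then show ?thesis using that[of 1] by auto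
  next
    case False
    from continuous_attains_inf[OF cD False contN] obtain a0
      where a0: "a0 \<in> D" "\<And>a. a \<in> D \<Longrightarrow> ?N a0 \<le> ?N a" by blast
    have "?N a0 \<noteq> 0"
    proof
      assume "?N a0 = 0"
      with a0(1) have "\<forall>i\<in>T. a0 i = 0" by (intro npos) (auto simp: D_def)
      then have "(\<Sum>i\<in>T. \<bar>a0 i\<bar>) = 0" by simp
      with a0(1) show False by (simp add: D_def)
    qed
    then have "?N a0 > 0" by (metis norm_ge_zero order_less_le)
    with a0 show ?thesis using that[of "?N a0"] by auto
  qed
  have "c * (\<Sum>i\<in>T. \<bar>a i\<bar>) \<le> ?N a" if a: "\<forall>i\<in>K. 0 \<le> a i" for a
  proof (cases "(\<Sum>i\<in>T. \<bar>a i\<bar>) = 0")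
    case False
    define s where "s = (\<Sum>i\<in>T. \<bar>a i\<bar>)"
    have s: "s > 0" using False unfolding s_def
      by (metis abs_ge_zero order_less_le sum_nonneg)
    define b where "b = (\<lambda>i. if i \<in> T then a i / s else 0)"
    have le: "\<bar>a i\<bar> \<le> s" if "i \<in> T" for i
      unfolding s_def using member_le_sum[of i T "\<lambda>i. \<bar>a i\<bar>"] that fin by auto
    have "(\<Sum>i\<in>T. \<bar>b i\<bar>) = (\<Sum>i\<in>T. \<bar>a i\<bar> / s)"
      using s by (intro sum.cong) (auto simp: b_def)
    also have "\<dots> = 1" using s by (simp add: sum_divide_distrib[symmetric] s_def[symmetric])
    finally have "(\<Sum>i\<in>T. \<bar>b i\<bar>) = 1" .
    moreover have "b i \<in> {-1..1}" if "i \<in> T" for i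
      using le[OF that] s that by (auto simp: b_def field_simps abs_le_iff)
    moreover have "\<forall>i\<in>K. 0 \<le> b i" using a s \<open>K \<subseteq> T\<close> by (auto simp: b_def)
    ultimately have "b \<in> D" by (auto simp: D_def PiE_iff b_def)
    then have "c \<le> ?N b" by (rule c)
    also have "(\<Sum>i\<in>T. b i *\<^sub>R v i) = (1/s) *\<^sub>R (\<Sum>i\<in>T. a i *\<^sub>R v i)"
      by (auto simp: b_def scaleR_sum_right intro!: sum.cong)
    finally have "c \<le> ?N a / s" using s by simp
    then show ?thesis using s by (simp add: s_def[symmetric] field_simps)
  qed simp
  with c show ?thesis using that by blast
qed

text \<open>Moving each vector by less than c/2 changes the combination by at most c/2 times the
  l1-norm of the coefficients, so half the constant survives, on a neighbourhood that does not
  depend on the coefficients.\<close>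

lemma coeff_norm_lower_bound_nearby:
  fixes G :: "nat \<Rightarrow> 'c::t2_space \<Rightarrow> 'b::real_normed_vector"
  assumes fin: "finite T" and "K \<subseteq> T"
    and npos: "\<And>a. (\<forall>i\<in>K. 0 \<le> a i) \<Longrightarrow> (\<Sum>i\<in>T. a i *\<^sub>R G i zb) = 0 \<Longrightarrow> \<forall>i\<in>T. a i = 0"
    and cont: "\<And>i. i \<in> T \<Longrightarrow> continuous_on UNIV (G i)"
  obtains c where "c > 0"
    "\<forall>\<^sub>F z in nhds zb. \<forall>a. (\<forall>i\<in>K. 0 \<le> a i) \<longrightarrow> c * (\<Sum>i\<in>T. \<bar>a i\<bar>) \<le> norm (\<Sum>i\<in>T. a i *\<^sub>R G i z)"
proof -
  from coeff_norm_lower_bound[OF fin \<open>K \<subseteq> T\<close>, of "\<lambda>i. G i zb"] npos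
  obtain c where c: "c > 0"
    "\<And>a. (\<forall>i\<in>K. 0 \<le> a i) \<Longrightarrow> c * (\<Sum>i\<in>T. \<bar>a i\<bar>) \<le> norm (\<Sum>i\<in>T. a i *\<^sub>R G i zb)"
    by blast
  have "\<forall>\<^sub>F z in nhds zb. \<forall>i\<in>T. dist (G i z) (G i zb) < c/2"
  proof (intro eventually_ball_finite[OF fin] ballI)
    fix i assume "i \<in> T"
    then have "(G i \<longlongrightarrow> G i zb) (nhds zb)"
      using cont continuous_on_eq_continuous_at[OF open_UNIV, of "G i"]
      by (auto simp: continuous_at tendsto_at_iff_tendsto_nhds)
    then show "\<forall>\<^sub>F z in nhds zb. dist (G i z) (G i zb) < c/2"
      using \<open>c > 0\<close> by (intro tendstoD) auto
  qed
  then have "\<forall>\<^sub>F z in nhds zb. \<forall>a. (\<forall>i\<in>K. 0 \<le> a i) \<longrightarrow>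
      (c/2) * (\<Sum>i\<in>T. \<bar>a i\<bar>) \<le> norm (\<Sum>i\<in>T. a i *\<^sub>R G i z)"
  proof (rule eventually_mono, intro allI impI)
    fix z and a :: "nat \<Rightarrow> real"
    assume z: "\<forall>i\<in>T. dist (G i z) (G i zb) < c/2" and a: "\<forall>i\<in>K. 0 \<le> a i"
    have le: "norm (a i *\<^sub>R (G i zb - G i z)) \<le> \<bar>a i\<bar> * (c/2)" if "i \<in> T" for i
    proof -
      have "norm (G i zb - G i z) \<le> c/2"
        using z that by (auto simp: dist_norm norm_minus_commute dest!: bspec)
      then show ?thesis by (simp add: mult_left_mono del: times_divide_eq_right)
    qed
    have "norm ((\<Sum>i\<in>T. a i *\<^sub>R G i zb) - (\<Sum>i\<in>T. a i *\<^sub>R G i z))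
        = norm (\<Sum>i\<in>T. a i *\<^sub>R (G i zb - G i z))"
      by (simp add: sum_subtractf scaleR_diff_right)
    also have "\<dots> \<le> (\<Sum>i\<in>T. \<bar>a i\<bar> * (c/2))"
      by (intro order_trans[OF norm_sum] sum_mono le)
    finally have 1: "norm ((\<Sum>i\<in>T. a i *\<^sub>R G i zb) - (\<Sum>i\<in>T. a i *\<^sub>R G i z)) \<le> (c/2) * (\<Sum>i\<in>T. \<bar>a i\<bar>)"
      by (simp add: sum_distrib_left mult.commute)
    have "c * (\<Sum>i\<in>T. \<bar>a i\<bar>) \<le> norm (\<Sum>i\<in>T. a i *\<^sub>R G i zb)" using c a by blast
    with 1 norm_triangle_ineq2[of "\<Sum>i\<in>T. a i *\<^sub>R G i zb" "\<Sum>i\<in>T. a i *\<^sub>R G i z"]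
    show "(c/2) * (\<Sum>i\<in>T. \<bar>a i\<bar>) \<le> norm (\<Sum>i\<in>T. a i *\<^sub>R G i z)" by linarith
  qed
  then show ?thesis using that[of "c/2"] c by auto
qed

section \<open>Indexed families: independence, spans and conic reduction\<close>

lemma not_lin_dep_famD:
  "\<not> lin_dep_fam v S \<Longrightarrow> (\<Sum>i\<in>S. c i *\<^sub>R v i) = 0 \<Longrightarrow> \<forall>i\<in>S. c i = 0"
  unfolding lin_dep_fam_def by blast

text \<open>A repeated vector makes an indexed family dependent, with coefficients 1 and -1.
  Injectivity is what allows passing from families to sets, on which \<open>dim\<close> and
  \<open>span\<close> operate.\<close>

lemma not_lin_dep_fam_inj_on:
  assumes "finite S" "\<not> lin_dep_fam v S"
  shows "inj_on v S"
proof (rule inj_onI, rule ccontr)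
  fix i j assume ij: "i \<in> S" "j \<in> S" "v i = v j" "i \<noteq> j"
  let ?c = "\<lambda>k. if k = i then 1 else if k = j then -1 else (0::real)"
  have "(\<Sum>k\<in>S. ?c k *\<^sub>R v k) = (\<Sum>k\<in>{i,j}. ?c k *\<^sub>R v k)"
    using ij assms(1) by (intro sum.mono_neutral_right) auto
  also have "\<dots> = 0" using ij by simp
  finally show False using not_lin_dep_famD[OF assms(2), of ?c] ij by auto
qed

lemma not_lin_dep_fam_dim:
  fixes v :: "nat \<Rightarrow> 'b::euclidean_space"
  assumes "finite S" "\<not> lin_dep_fam v S"
  shows "dim (v ` S) = card S"
proof -
  have inj: "inj_on v S" by (rule not_lin_dep_fam_inj_on[OF assms])
  have "independent (v ` S)"
  proof (rule independent_if_scalars_zero)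
    fix g x assume s: "(\<Sum>x\<in>v ` S. g x *\<^sub>R x) = 0" and x: "x \<in> v ` S"
    have "(\<Sum>i\<in>S. g (v i) *\<^sub>R v i) = 0"
      using s by (simp add: sum.reindex[OF inj])
    then have "\<forall>i\<in>S. g (v i) = 0"
      using not_lin_dep_famD[OF assms(2), of "\<lambda>i. g (v i)"] by blast
    then show "g x = 0" using x by auto
  qed (use assms in auto)
  then show ?thesis
    by (simp add: dim_eq_card_independent card_image[OF inj])
qed

lemma span_image_finite:
  assumes "finite S" "u \<in> span (v ` S)"
  shows "\<exists>c. u = (\<Sum>i\<in>S. c i *\<^sub>R v i)"
  using assms(2)
proof (induction rule: span_induct_alt)
  case base
  then show ?case by (intro exI[of _ "\<lambda>_. 0"]) simp
next
  case (step c x y)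
  then obtain j d where j: "j \<in> S" "x = v j" and d: "y = (\<Sum>i\<in>S. d i *\<^sub>R v i)" by blast
  have "c *\<^sub>R x + y = (\<Sum>i\<in>S. (if i = j then c *\<^sub>R v i else 0) + d i *\<^sub>R v i)"
    using j assms(1) by (simp add: sum.distrib d)
  also have "\<dots> = (\<Sum>i\<in>S. ((if i = j then c else 0) + d i) *\<^sub>R v i)"
    by (intro sum.cong) (auto simp: scaleR_add_left)
  finally show ?case by (intro exI[of _ "\<lambda>i. (if i = j then c else 0) + d i"])
qed

text \<open>Since \<open>S\<close> is independent, every dependence relation of
  \<open>K \<union> S\<close> involves \<open>K\<close>. Moving along it until the first coefficient
  on \<open>K\<close> vanishes removes one index of \<open>K\<close> and leaves \<open>S\<close>
  intact. That the new support lies in the old positive support keeps multipliers on violated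
  constraints only.\<close>

lemma cone_caratheodory_modulo_independent:
  fixes v :: "nat \<Rightarrow> 'b::real_vector"
  assumes "finite K" "finite S" "K \<inter> S = {}" "\<not> lin_dep_fam v S" "\<forall>i\<in>K. 0 \<le> a i"
  shows "\<exists>L b. L \<subseteq> {i\<in>K. 0 < a i} \<and> (\<forall>i\<in>L. 0 \<le> b i) \<and> \<not> lin_dep_fam v (L \<union> S)
           \<and> (\<Sum>i\<in>L \<union> S. b i *\<^sub>R v i) = (\<Sum>i\<in>K \<union> S. a i *\<^sub>R v i)"
  using assms
proof (induction "card K" arbitrary: K a rule: less_induct)
  case less
  \<comment> \<open>The coefficients are quantified afresh, because this is applied to
    \<open>a\<close> and to the shifted \<open>a'\<close>.\<close>
  have "(\<Sum>i\<in>(K - {i}) \<union> S. a i *\<^sub>R v i) = (\<Sum>i\<in>K \<union> S. a i *\<^sub>R v i)"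
    if "i \<in> K" "a i = 0" for i a
    using that less.prems by (intro sum.mono_neutral_left) auto
  note drop = this
  show ?case
  proof (cases "\<exists>i\<in>K. a i = 0")
    case True
    then obtain i where i: "i \<in> K" "a i = 0" by blast
    have "\<exists>L b. L \<subseteq> {j\<in>K-{i}. 0 < a j} \<and> (\<forall>i\<in>L. 0 \<le> b i) \<and> \<not> lin_dep_fam v (L \<union> S)
      \<and> (\<Sum>i\<in>L \<union> S. b i *\<^sub>R v i) = (\<Sum>i\<in>K-{i} \<union> S. a i *\<^sub>R v i)"
      proof (rule less.hyps)
        show "card (K - {i}) < card K" using less.prems i by (intro card_Diff1_less)
      qed (use less.prems i in auto)
    then obtain L b where "L \<subseteq> {j\<in>K-{i}. 0 < a j}" "\<forall>i\<in>L. 0 \<le> b i" "\<not> lin_dep_fam v (L \<union> S)"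
      "(\<Sum>i\<in>L \<union> S. b i *\<^sub>R v i) = (\<Sum>i\<in>K-{i} \<union> S. a i *\<^sub>R v i)"
      by blast
    with drop[of i a, OF i] show ?thesis by (intro exI[of _ L] exI[of _ b]) auto
  next
    case pos: False
    show ?thesis
    proof (cases "lin_dep_fam v (K \<union> S)")
      case False
      with pos less.prems show ?thesis by (intro exI[of _ K] exI[of _ a]) force
    next
      case True
      then obtain c0 where c0: "\<exists>i\<in>K \<union> S. c0 i \<noteq> 0" "(\<Sum>i\<in>K \<union> S. c0 i *\<^sub>R v i) = 0"
        unfolding lin_dep_fam_def by blast
      have "\<exists>i\<in>K. c0 i \<noteq> 0"
      proof (rule ccontr)
        assume n: "\<not> (\<exists>i\<in>K. c0 i \<noteq> 0)"
        have "(\<Sum>i\<in>S. c0 i *\<^sub>R v i) = (\<Sum>i\<in>K \<union> S. c0 i *\<^sub>R v i)"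
          using n less.prems by (intro sum.mono_neutral_left) auto
        with c0 not_lin_dep_famD[OF less.prems(4), of c0] n show False by auto
      qed
      then obtain i0 where i0: "i0 \<in> K" "c0 i0 \<noteq> 0" by blast
      \<comment> \<open>The sign makes the coefficient at \<open>i0\<close> positive, so that the
        ratio test below has a candidate.\<close>
      define c where "c = (\<lambda>i. sgn (c0 i0) * c0 i)"
      have c: "(\<Sum>i\<in>K \<union> S. c i *\<^sub>R v i) = 0"
        using c0(2) by (simp add: c_def scaleR_scaleR[symmetric] scaleR_sum_right[symmetric]
            del: scaleR_scaleR)
      have ci0: "c i0 > 0" using i0 by (auto simp: c_def sgn_if)
      define P where "P = {i\<in>K. c i > 0}"
      have P: "finite P" "P \<noteq> {}" using less.prems i0 ci0 by (auto simp: P_def)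
      \<comment> \<open>The smallest ratio is the largest step \<open>t\<close> that keeps all
        coefficients on \<open>K\<close> nonnegative; at \<open>k\<close> the coefficient becomes
        0.\<close>
      obtain k where k: "k \<in> P" "\<And>i. i \<in> P \<Longrightarrow> a k / c k \<le> a i / c i"
        using ex_min_if_finite[of "(\<lambda>i. a i / c i) ` P"] P
        by (metis (no_types, lifting) arg_min_if_finite(1) arg_min_least)
      define t where "t = a k / c k"
      have kK: "k \<in> K" "c k > 0" using k by (auto simp: P_def)
      have t: "t > 0" using kK pos less.prems unfolding t_def by (force simp: less_le)
      define a' where "a' = (\<lambda>i. a i - t * c i)"
      have a'k: "a' k = 0" using kK by (simp add: a'_def t_def)
      have a'pos: "\<forall>i\<in>K. 0 \<le> a' i"
      proof
        fix i assume i: "i \<in> K"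
        show "0 \<le> a' i"
        proof (cases "c i > 0")
          case True
          then have "t \<le> a i / c i" using k i unfolding t_def P_def by auto
          with True show ?thesis by (simp add: a'_def field_simps)
        next
          case False
          with t have "t * c i \<le> 0" by (simp add: mult_nonneg_nonpos)
          with less.prems i show ?thesis by (force simp: a'_def)
        qed
      qed
      have "(\<Sum>i\<in>K \<union> S. a' i *\<^sub>R v i)
          = (\<Sum>i\<in>K \<union> S. a i *\<^sub>R v i) - t *\<^sub>R (\<Sum>i\<in>K \<union> S. c i *\<^sub>R v i)"
        by (simp add: a'_def scaleR_diff_left sum_subtractf scaleR_sum_right)
      then have eq: "(\<Sum>i\<in>K \<union> S. a' i *\<^sub>R v i) = (\<Sum>i\<in>K \<union> S. a i *\<^sub>R v i)"
        using c by simp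
      have "\<exists>L b. L \<subseteq> {j\<in>K-{k}. 0 < a' j} \<and> (\<forall>i\<in>L. 0 \<le> b i) \<and> \<not> lin_dep_fam v (L \<union> S)
      \<and> (\<Sum>i\<in>L \<union> S. b i *\<^sub>R v i) = (\<Sum>i\<in>K-{k} \<union> S. a' i *\<^sub>R v i)"
      proof (rule less.hyps)
        show "card (K - {k}) < card K" using less.prems kK by (intro card_Diff1_less)
      qed (use less.prems kK a'pos in auto)
    then obtain L b where "L \<subseteq> {j\<in>K-{k}. 0 < a' j}" "\<forall>i\<in>L. 0 \<le> b i" "\<not> lin_dep_fam v (L \<union> S)"
        "(\<Sum>i\<in>L \<union> S. b i *\<^sub>R v i) = (\<Sum>i\<in>K-{k} \<union> S. a' i *\<^sub>R v i)"
        by blast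
      \<comment> \<open>In this case all \<open>a i\<close> on \<open>K\<close> are positive, so a
        support contained in \<open>K\<close> is also a support for \<open>a\<close>.\<close>
      with drop[of k a', OF kK(1) a'k] eq pos less.prems(5) show ?thesis
        by (intro exI[of _ L] exI[of _ b]) (force simp: less_le)
    qed
  qed
qed

text \<open>RCPLD for an abstract gradient family, with the inequality index set \<open>A\<close> as
  a parameter: \<open>A\<close> is the active set with index 0 for the solution map and without it
  for the feasible set map.\<close>

definition rcpld :: "(nat \<Rightarrow> 'c::t2_space \<Rightarrow> 'b::euclidean_space) \<Rightarrow> nat set \<Rightarrow> nat set \<Rightarrow> 'c \<Rightarrow> bool" where
  "rcpld G A E zb \<longleftrightarrow>
     (\<exists>U S. open U \<and> zb \<in> U \<and> S \<subseteq> E \<and>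
        \<not> lin_dep_fam (\<lambda>i. G i zb) S \<and>
        span ((\<lambda>i. G i zb) ` S) = span ((\<lambda>i. G i zb) ` E) \<and>
        (\<forall>z\<in>U. \<forall>z'\<in>U. dim ((\<lambda>i. G i z) ` E) = dim ((\<lambda>i. G i z') ` E)) \<and>
        (\<forall>K\<subseteq>A. pos_lin_dep (\<lambda>i. G i zb) K (\<lambda>i. G i zb) S \<longrightarrow>
             (\<forall>z\<in>U. lin_dep_fam (\<lambda>i. G i z) (K \<union> S))))"

lemma RCPLD_S_iff_rcpld:
  "RCPLD_S f h l p xb yb \<longleftrightarrow>
     rcpld (gy f h) ({0} \<union> {i\<in>{1..l}. h i (xb, yb) = 0}) {l+1..p} (xb, yb)"
  unfolding RCPLD_S_def rcpld_def by (rule refl)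

lemma rcpld_subset: "rcpld G A E zb \<Longrightarrow> B \<subseteq> A \<Longrightarrow> rcpld G B E zb"
  unfolding rcpld_def by (meson order_trans)

lemma not_pos_lin_depD:
  assumes "\<not> pos_lin_dep v K v S" "finite K" "finite S" "K \<inter> S = {}"
    "\<forall>i\<in>K. 0 \<le> a i" "(\<Sum>i\<in>K \<union> S. a i *\<^sub>R v i) = 0"
  shows "\<forall>i\<in>K \<union> S. a i = 0"
proof (rule ccontr)
  assume "\<not> ?thesis"
  with assms show False unfolding pos_lin_dep_def
    by (auto simp: sum.union_disjoint)
qed

text \<open>A single coefficient family over \<^term>\<open>A \<union> E\<close> carries both the inequality multipliers
  (nonnegative, on \<^term>\<open>A\<close>) and the equality multipliers (on \<^term>\<open>E\<close>).\<close>

lemma rcpld_bounded_multipliers: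
  fixes G :: "nat \<Rightarrow> 'c::t2_space \<Rightarrow> 'b::euclidean_space"
  assumes rc: "rcpld G A E zb" and fin: "finite A" "finite E" and disj: "A \<inter> E = {}"
    and cont: "\<And>i. i \<in> A \<union> E \<Longrightarrow> continuous_on UNIV (G i)"
  obtains M where "M > 0"
    "\<forall>\<^sub>F z in nhds zb. \<forall>a. (\<forall>i\<in>A. 0 \<le> a i) \<longrightarrow>
       (\<exists>b. (\<forall>i\<in>A. 0 \<le> b i \<and> (0 < b i \<longrightarrow> 0 < a i))
          \<and> (\<Sum>i\<in>A \<union> E. b i *\<^sub>R G i z) = (\<Sum>i\<in>A \<union> E. a i *\<^sub>R G i z)
          \<and> (\<Sum>i\<in>A \<union> E. \<bar>b i\<bar>) \<le> M * norm (\<Sum>i\<in>A \<union> E. a i *\<^sub>R G i z))"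
proof -
  obtain U S where U: "open U" "zb \<in> U" and SE: "S \<subseteq> E"
    and ind: "\<not> lin_dep_fam (\<lambda>i. G i zb) S"
    and sp: "span ((\<lambda>i. G i zb) ` S) = span ((\<lambda>i. G i zb) ` E)"
    and rank: "\<forall>z\<in>U. \<forall>z'\<in>U. dim ((\<lambda>i. G i z) ` E) = dim ((\<lambda>i. G i z') ` E)"
    and dep: "\<forall>K\<subseteq>A. pos_lin_dep (\<lambda>i. G i zb) K (\<lambda>i. G i zb) S \<longrightarrow>
       (\<forall>z\<in>U. lin_dep_fam (\<lambda>i. G i z) (K \<union> S))"
    using rc unfolding rcpld_def by (elim exE conjE) (rule that; assumption)
  have finS: "finite S" using SE fin finite_subset by auto
  have AS: "A \<inter> S = {}" using SE disj by auto
  \<comment> \<open>There are finitely many index sets of this kind, so their constants and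
    neighbourhoods can be merged. The set produced by the reduction varies with the point and the
    coefficients, but it always belongs to this collection.\<close>
  define NP where "NP = {K. K \<subseteq> A \<and> \<not> pos_lin_dep (\<lambda>i. G i zb) K (\<lambda>i. G i zb) S}"
  have finNP: "finite NP" unfolding NP_def using fin by auto
  define low where "low = (\<lambda>K c z. \<forall>a. (\<forall>i\<in>K. 0 \<le> a i) \<longrightarrow>
      c * (\<Sum>i\<in>K \<union> S. \<bar>a i\<bar>) \<le> norm (\<Sum>i\<in>K \<union> S. a i *\<^sub>R G i z))"
  have "\<exists>c>0. \<forall>\<^sub>F z in nhds zb. low K c z" if "K \<in> NP" for K
  proof -
    have K: "K \<subseteq> A" "finite K" and np: "\<not> pos_lin_dep (\<lambda>i. G i zb) K (\<lambda>i. G i zb) S"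
      using that fin finite_subset by (auto simp: NP_def)
    have KS: "K \<inter> S = {}" using K AS by auto
    have TAE: "K \<union> S \<subseteq> A \<union> E" using K SE by auto
    have contT: "\<And>i. i \<in> K \<union> S \<Longrightarrow> continuous_on UNIV (G i)" using TAE cont by blast
    show ?thesis
    proof (rule coeff_norm_lower_bound_nearby[of "K \<union> S" K G zb])
      fix c assume "0 < c" "\<forall>\<^sub>F z in nhds zb. \<forall>a. (\<forall>i\<in>K. 0 \<le> a i) \<longrightarrow>
        c * (\<Sum>i\<in>K \<union> S. \<bar>a i\<bar>) \<le> norm (\<Sum>i\<in>K \<union> S. a i *\<^sub>R G i z)"
      then show ?thesis unfolding low_def by blast
    qed (use not_pos_lin_depD[OF np K(2) finS KS] finS K contT in auto)
  qed
  then obtain C where C: "\<And>K. K \<in> NP \<Longrightarrow> C K > 0" "\<And>K. K \<in> NP \<Longrightarrow> \<forall>\<^sub>F z in nhds zb. low K (C K) z"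
    by metis
  have "{} \<in> NP"
    using ind unfolding NP_def pos_lin_dep_def lin_dep_fam_def by auto
  \<comment> \<open>The sum dominates every \<open>1 / C K\<close>; it is positive because the empty
    set belongs to \<open>NP\<close>.\<close>
  define M where "M = (\<Sum>K\<in>NP. 1 / C K)"
  have CM: "1 / C K \<le> M" if "K \<in> NP" for K
    unfolding M_def using that C finNP
    by (intro member_le_sum) (auto intro: less_imp_le)
  have M: "M > 0" using CM[OF \<open>{} \<in> NP\<close>] C(1)[OF \<open>{} \<in> NP\<close>] by (meson less_le_trans zero_less_divide_1_iff)
  have ev: "\<forall>\<^sub>F z in nhds zb. z \<in> U \<and> (\<forall>K\<in>NP. low K (C K) z)"
    using C(2) finNP U by (intro eventually_conj eventually_ball_finite ballI eventually_nhds_in_open) auto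
  show ?thesis
  proof (rule that[OF M], rule eventually_mono[OF ev], intro allI impI)
    fix z and a :: "nat \<Rightarrow> real"
    assume z: "z \<in> U \<and> (\<forall>K\<in>NP. low K (C K) z)" and a: "\<forall>i\<in>A. 0 \<le> a i"
    let ?v = "\<lambda>i. G i z"
    \<comment> \<open>The lower bound for the empty inequality set says precisely that
      \<open>S\<close> stays independent near \<open>zb\<close>.\<close>
    have indz: "\<not> lin_dep_fam ?v S"
    proof
      assume "lin_dep_fam ?v S"
      then obtain c i where c: "i \<in> S" "c i \<noteq> 0" "(\<Sum>i\<in>S. c i *\<^sub>R ?v i) = 0"
        unfolding lin_dep_fam_def by blast
      have "low {} (C {}) z" using z \<open>{} \<in> NP\<close> by blast
      then have "\<forall>a. C {} * (\<Sum>i\<in>S. \<bar>a i\<bar>) \<le> norm (\<Sum>i\<in>S. a i *\<^sub>R ?v i)"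
        unfolding low_def by simp
      from spec[OF this, of c] c(3) have "C {} * (\<Sum>i\<in>S. \<bar>c i\<bar>) \<le> 0" by simp
      then have "(\<Sum>i\<in>S. \<bar>c i\<bar>) \<le> 0" using C(1)[OF \<open>{} \<in> NP\<close>]
        by (simp add: mult_le_0_iff)
      moreover have "\<bar>c i\<bar> \<le> (\<Sum>i\<in>S. \<bar>c i\<bar>)" using c finS by (intro member_le_sum) auto
      ultimately show False using c by auto
    qed
    \<comment> \<open>Constant rank keeps the dimension of the equality span equal to
      \<open>card S\<close>, so the independent vectors indexed by \<open>S\<close> still span it at
      \<open>z\<close>. The equality part can then be rewritten over \<open>S\<close>.\<close>
    have "dim (?v ` E) = dim ((\<lambda>i. G i zb) ` E)" using rank z U by blast
    also have "\<dots> = dim ((\<lambda>i. G i zb) ` S)" using sp by (metis dim_span)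
    also have "\<dots> = card S" by (rule not_lin_dep_fam_dim[OF finS ind])
    also have "\<dots> = dim (?v ` S)" by (rule not_lin_dep_fam_dim[OF finS indz, symmetric])
    finally have "span (?v ` S) = span (?v ` E)"
      using SE by (intro dim_eq_span) auto
    moreover have "(\<Sum>i\<in>E. a i *\<^sub>R ?v i) \<in> span (?v ` E)"
      by (intro span_sum span_scale span_base) auto
    ultimately obtain s where s: "(\<Sum>i\<in>E. a i *\<^sub>R ?v i) = (\<Sum>i\<in>S. s i *\<^sub>R ?v i)"
      using span_image_finite[OF finS, of _ ?v] by metis
    define a' where "a' = (\<lambda>i. if i \<in> A then a i else s i)"
    have sA: "(\<Sum>i\<in>A. a' i *\<^sub>R ?v i) = (\<Sum>i\<in>A. a i *\<^sub>R ?v i)"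
      by (intro sum.cong) (auto simp: a'_def)
    have sS: "(\<Sum>i\<in>S. a' i *\<^sub>R ?v i) = (\<Sum>i\<in>S. s i *\<^sub>R ?v i)"
      using AS by (intro sum.cong) (auto simp: a'_def)
    have a'eq: "(\<Sum>i\<in>A \<union> S. a' i *\<^sub>R ?v i) = (\<Sum>i\<in>A \<union> E. a i *\<^sub>R ?v i)"
      using fin finS AS disj s by (simp add: sum.union_disjoint sA sS)
    obtain L b where L: "L \<subseteq> {i\<in>A. 0 < a' i}" "\<forall>i\<in>L. 0 \<le> b i" "\<not> lin_dep_fam ?v (L \<union> S)"
      "(\<Sum>i\<in>L \<union> S. b i *\<^sub>R ?v i) = (\<Sum>i\<in>A \<union> S. a' i *\<^sub>R ?v i)"
      using cone_caratheodory_modulo_independent[OF fin(1) finS AS indz, of a'] a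
      unfolding a'_def by auto
    have LA: "L \<subseteq> A" using L by auto
    \<comment> \<open>Contrapositive of condition (iii): independence of \<open>L \<union> S\<close>
      at the single point \<open>z\<close> of \<open>U\<close> excludes positive-linear dependence
      at \<open>zb\<close>.\<close>
    have "L \<in> NP" using dep L(3) z LA unfolding NP_def by blast
    then have "low L (C L) z" and CL: "C L > 0" using z C by auto
    then have "C L * (\<Sum>i\<in>L \<union> S. \<bar>b i\<bar>) \<le> norm (\<Sum>i\<in>L \<union> S. b i *\<^sub>R ?v i)"
      using L unfolding low_def by blast
    then have "(\<Sum>i\<in>L \<union> S. \<bar>b i\<bar>) \<le> 1 / C L * norm (\<Sum>i\<in>L \<union> S. b i *\<^sub>R ?v i)"
      using CL by (simp add: field_simps)
    also have "\<dots> \<le> M * norm (\<Sum>i\<in>L \<union> S. b i *\<^sub>R ?v i)"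
      by (intro mult_right_mono CM \<open>L \<in> NP\<close>) auto
    finally have bd: "(\<Sum>i\<in>L \<union> S. \<bar>b i\<bar>) \<le> M * norm (\<Sum>i\<in>A \<union> E. a i *\<^sub>R ?v i)"
      using L a'eq by simp
    define b' where "b' = (\<lambda>i. if i \<in> L \<union> S then b i else 0)"
    have 1: "(\<Sum>i\<in>A \<union> E. b' i *\<^sub>R ?v i) = (\<Sum>i\<in>L \<union> S. b i *\<^sub>R ?v i)"
      using LA SE fin by (intro sum.mono_neutral_cong_right) (auto simp: b'_def)
    have 2: "(\<Sum>i\<in>A \<union> E. \<bar>b' i\<bar>) = (\<Sum>i\<in>L \<union> S. \<bar>b i\<bar>)"
      using LA SE fin by (intro sum.mono_neutral_cong_right) (auto simp: b'_def)
    have 3: "\<forall>i\<in>A. 0 \<le> b' i \<and> (0 < b' i \<longrightarrow> 0 < a i)"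
      using L AS by (auto simp: b'_def a'_def)
    show "\<exists>b. (\<forall>i\<in>A. 0 \<le> b i \<and> (0 < b i \<longrightarrow> 0 < a i))
          \<and> (\<Sum>i\<in>A \<union> E. b i *\<^sub>R ?v i) = (\<Sum>i\<in>A \<union> E. a i *\<^sub>R ?v i)
          \<and> (\<Sum>i\<in>A \<union> E. \<bar>b i\<bar>) \<le> M * norm (\<Sum>i\<in>A \<union> E. a i *\<^sub>R ?v i)"
      using 1 2 3 bd L a'eq by (intro exI[of _ b']) simp
  qed
qed

section \<open>Projections and approximate KKT points\<close>

text \<open>Makes the inequality penalty differentiable across the boundary; at 0 the difference
  quotient is at most \<open>\<bar>h\<bar>\<close> in absolute value.\<close>

lemma has_field_derivative_max0_square:
  "((\<lambda>t::real. (max 0 t)\<^sup>2) has_field_derivative 2 * max 0 t) (at t)"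
proof -
  consider "t > 0" | "t < 0" | "t = 0" by linarith
  then show ?thesis
  proof cases
    case 1
    have "((\<lambda>t::real. t\<^sup>2) has_field_derivative 2 * max 0 t) (at t)"
      using 1 by (auto intro!: derivative_eq_intros)
    then show ?thesis
      by (rule has_field_derivative_transform_within_open[of _ _ _ "{0<..}"]) (use 1 in auto)
  next
    case 2
    have "((\<lambda>t::real. 0) has_field_derivative 2 * max 0 t) (at t)"
      using 2 by (auto intro!: derivative_eq_intros)
    then show ?thesis
      by (rule has_field_derivative_transform_within_open[of _ _ _ "{..<0}"]) (use 2 in auto)
  next
    case 3
    have "((\<lambda>h::real. (max 0 h)\<^sup>2 / h) \<longlongrightarrow> 0) (at 0)"
    proof (rule Lim_null_comparison)
      show "\<forall>\<^sub>F h in at 0. norm ((max 0 h)\<^sup>2 / h) \<le> \<bar>h\<bar>"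
        by (auto simp: max_def power2_eq_square)
    qed (auto intro!: tendsto_eq_intros)
    then show ?thesis using 3 by (simp add: has_field_derivative_iff)
  qed
qed

text \<open>Quadratic penalisation of the projection problem; the term \<open>\<parallel>w - z\<parallel>\<^sup>2\<close> makes \<open>z\<close> its unique
  solution, so that penalised minimisers on a small ball around \<open>z\<close> lie in the interior.
  No constraint qualification is involved.\<close>

lemma approximate_KKT_projection:
  fixes g :: "nat \<Rightarrow> 'b::euclidean_space \<Rightarrow> real"
  assumes fin: "finite A" "finite E" and disj: "A \<inter> E = {}"
    and der: "\<And>i w. i \<in> A \<union> E \<Longrightarrow> (g i has_derivative (\<lambda>d. G i w \<bullet> d)) (at w)"
    and z: "\<forall>i\<in>A. g i z \<le> 0" "\<forall>i\<in>E. g i z = 0"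
    and proj: "\<And>w. \<forall>i\<in>A. g i w \<le> 0 \<Longrightarrow> \<forall>i\<in>E. g i w = 0 \<Longrightarrow> dist y z \<le> dist y w"
    and \<delta>: "\<delta> > 0"
  obtains w a where "dist w z < \<delta>" "\<forall>i\<in>A. 0 \<le> a i \<and> (0 < a i \<longrightarrow> 0 < g i w)"
    "(y - w) + (z - w) = (\<Sum>i\<in>A \<union> E. a i *\<^sub>R G i w)"
proof -
  define H where "H = (\<lambda>w. (w - y) \<bullet> (w - y) + (w - z) \<bullet> (w - z))"
  define P where "P = (\<lambda>w. (\<Sum>i\<in>A. (max 0 (g i w))\<^sup>2) + (\<Sum>i\<in>E. (g i w)\<^sup>2))"
  have contg: "continuous_on S (g i)" if "i \<in> A \<union> E" for i S
    using der[OF that] by (meson continuous_at_imp_continuous_on has_derivative_continuous)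
  have contH: "continuous_on S H" for S unfolding H_def by (intro continuous_intros)
  have contP: "continuous_on S P" for S
    unfolding P_def by (intro continuous_intros contg) auto
  have P0: "P w \<ge> 0" for w unfolding P_def by (intro add_nonneg_nonneg sum_nonneg) auto
  have Pz: "P z = 0" using z by (simp add: P_def)
  have H0: "H w \<ge> 0" for w unfolding H_def by simp
  have Hz: "H z = (dist y z)\<^sup>2"
    by (simp add: H_def dist_norm norm_minus_commute[of y] power2_norm_eq_inner)
  have Peq: "(\<forall>i\<in>A. g i w \<le> 0) \<and> (\<forall>i\<in>E. g i w = 0)" if "P w = 0" for w
  proof -
    have nn: "(\<Sum>i\<in>A. (max 0 (g i w))\<^sup>2) \<ge> 0" "(\<Sum>i\<in>E. (g i w)\<^sup>2) \<ge> 0"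
      by (auto intro: sum_nonneg)
    with that have "(\<Sum>i\<in>A. (max 0 (g i w))\<^sup>2) = 0" "(\<Sum>i\<in>E. (g i w)\<^sup>2) = 0"
      unfolding P_def by linarith+
    then show ?thesis using fin by (auto simp: sum_nonneg_eq_0_iff max_def split: if_splits)
  qed
  \<comment> \<open>On the rest of the sphere \<open>H\<close> alone already exceeds its value at
    \<open>z\<close>. On \<open>Q\<close> there is no feasible point: there the distance term
    contributes \<open>\<delta>\<close> squared, while feasibility would make the other term at
    least \<open>H z\<close>.\<close>
  define Q where "Q = sphere z \<delta> \<inter> {w. H w \<le> H z}"
  have "closed {w. H w \<le> H z}"
    by (intro closed_Collect_le contH continuous_on_const)
  then have cQ: "compact Q" unfolding Q_def by (intro compact_Int_closed) auto
  have PQ: "P w > 0" if "w \<in> Q" for w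
  proof (rule ccontr)
    assume "\<not> P w > 0"
    then have "P w = 0" using P0[of w] by linarith
    then have "dist y z \<le> dist y w" using Peq proj by blast
    then have "H z \<le> (w - y) \<bullet> (w - y)"
      unfolding Hz by (simp add: dist_norm norm_minus_commute power_mono power2_norm_eq_inner[symmetric])
    moreover have "(w - z) \<bullet> (w - z) > 0"
      using that \<delta> by (auto simp: Q_def)
    moreover have "H w \<le> H z" using that by (simp add: Q_def)
    moreover have "H w = (w - y) \<bullet> (w - y) + (w - z) \<bullet> (w - z)" by (simp add: H_def)
    ultimately show False by linarith
  qed
  obtain m where m: "m > 0" "\<And>w. w \<in> Q \<Longrightarrow> m \<le> P w"
  proof (cases "Q = {}")
    case True
    then show ?thesis using that[of 1] by auto
  next
    case False
    from continuous_attains_inf[OF cQ False contP] obtain q where "q \<in> Q" "\<forall>w\<in>Q. P q \<le> P w"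
      by blast
    then show ?thesis using that[of "P q"] PQ by auto
  qed
  \<comment> \<open>The penalty weight is large enough for the penalty on \<open>Q\<close> alone to
    beat \<open>H z\<close>; the added 1 makes the inequality strict.\<close>
  define j where "j = (H z + 1) / m"
  have j: "j > 0" "j * m > H z" using m H0[of z] by (auto simp: j_def add_nonneg_pos)
  define F where "F = (\<lambda>w. H w + j * P w)"
  have Fz: "F z = H z" by (simp add: F_def Pz)
  have sph: "F w > F z" if "dist z w = \<delta>" for w
  proof (cases "w \<in> Q")
    case True
    then have "j * m \<le> j * P w" using m j by (intro mult_left_mono) auto
    moreover have "F w = H w + j * P w" by (simp add: F_def)
    ultimately show ?thesis unfolding Fz using j H0[of w] by linarith
  next
    case False
    then have "H w > H z" using that by (auto simp: Q_def)
    moreover have "j * P w \<ge> 0" using j P0[of w] by simp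
    ultimately show ?thesis unfolding Fz by (simp add: F_def)
  qed
  have contF: "continuous_on S F" for S unfolding F_def by (intro continuous_intros contH contP)
  have ne: "cball z \<delta> \<noteq> {}" using \<delta> by auto
  from continuous_attains_inf[OF compact_cball ne contF] obtain w
    where w: "w \<in> cball z \<delta>" "\<forall>u\<in>cball z \<delta>. F w \<le> F u" by blast
  have "F w \<le> F z" using w \<delta> by auto
  then have wb: "dist z w < \<delta>" using w sph[of w] by (cases "dist z w = \<delta>") auto
  \<comment> \<open>Half the derivative of the weighted penalty with respect to each constraint
    value; the factor 2 is cancelled against the gradient of \<open>H\<close>, which is minus twice
    the vector on the left.\<close>
  define a where "a = (\<lambda>i. if i \<in> A then j * max 0 (g i w) else j * g i w)"
  have dA: "((\<lambda>w. (max 0 (g i w))\<^sup>2) has_derivative (\<lambda>d. 2 * max 0 (g i w) * (G i w \<bullet> d))) (at w)"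
    if "i \<in> A" for i
    using has_derivative_compose[OF der[of i w]
        has_field_derivative_max0_square[unfolded has_field_derivative_def]] that by simp
  have dE: "((\<lambda>w. (g i w)\<^sup>2) has_derivative (\<lambda>d. 2 * g i w * (G i w \<bullet> d))) (at w)"
    if "i \<in> E" for i
    using der[of i w] that by (auto intro!: derivative_eq_intros)
  have dH: "(H has_derivative (\<lambda>d. 2 * ((w - y) \<bullet> d) + 2 * ((w - z) \<bullet> d))) (at w)"
    unfolding H_def by (auto intro!: derivative_eq_intros simp: inner_commute algebra_simps)
  have "(F has_derivative (\<lambda>d. (2 * ((w - y) \<bullet> d) + 2 * ((w - z) \<bullet> d))
      + j * ((\<Sum>i\<in>A. 2 * max 0 (g i w) * (G i w \<bullet> d)) + (\<Sum>i\<in>E. 2 * g i w * (G i w \<bullet> d))))) (at w)"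
    unfolding F_def P_def
    by (intro has_derivative_add dH has_derivative_mult_right has_derivative_sum dA dE)
  then have "(\<lambda>d. (2 * ((w - y) \<bullet> d) + 2 * ((w - z) \<bullet> d))
      + j * ((\<Sum>i\<in>A. 2 * max 0 (g i w) * (G i w \<bullet> d)) + (\<Sum>i\<in>E. 2 * g i w * (G i w \<bullet> d)))) = (\<lambda>v. 0)"
    using w wb by (intro differential_zero_maxmin[of w "ball z \<delta>" F]) auto
  then have zero: "(2 * ((w - y) \<bullet> d) + 2 * ((w - z) \<bullet> d))
      + j * ((\<Sum>i\<in>A. 2 * max 0 (g i w) * (G i w \<bullet> d)) + (\<Sum>i\<in>E. 2 * g i w * (G i w \<bullet> d))) = 0" for d
    by (rule fun_cong)
  have "((y - w) + (z - w)) \<bullet> d = (\<Sum>i\<in>A \<union> E. a i *\<^sub>R G i w) \<bullet> d" for d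
  proof -
    have 1: "2 * (\<Sum>i\<in>A. a i * (G i w \<bullet> d)) = j * (\<Sum>i\<in>A. 2 * max 0 (g i w) * (G i w \<bullet> d))"
      by (auto simp: sum_distrib_left a_def intro!: sum.cong)
    have 2: "2 * (\<Sum>i\<in>E. a i * (G i w \<bullet> d)) = j * (\<Sum>i\<in>E. 2 * g i w * (G i w \<bullet> d))"
      using disj by (auto simp: sum_distrib_left a_def intro!: sum.cong)
    have "2 * ((\<Sum>i\<in>A \<union> E. a i *\<^sub>R G i w) \<bullet> d)
      = 2 * (\<Sum>i\<in>A. a i * (G i w \<bullet> d)) + 2 * (\<Sum>i\<in>E. a i * (G i w \<bullet> d))"
      using fin disj by (simp add: sum.union_disjoint inner_add_left inner_sum_left)
    with 1 2 zero[of d] show ?thesis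
      by (simp add: algebra_simps inner_diff_left inner_add_left)
  qed
  then have "(y - w) + (z - w) = (\<Sum>i\<in>A \<union> E. a i *\<^sub>R G i w)"
    by (rule vector_eq_rdot[THEN iffD1, OF allI])
  moreover have "\<forall>i\<in>A. 0 \<le> a i \<and> (0 < a i \<longrightarrow> 0 < g i w)"
    using j by (auto simp: a_def max_def zero_less_mult_iff)
  ultimately show ?thesis using that[of w a] wb by (simp add: dist_commute)
qed

text \<open>The set \<open>C\<close> is closed and free of multipliers. Approximate KKT points
  arbitrarily close to \<open>z\<close> lie in it, hence so does \<open>z\<close>, where the
  equality defects vanish and the inequality can be divided by the norm of
  \<open>y - z\<close>.\<close>

lemma projection_distance_estimate:
  fixes g :: "nat \<Rightarrow> 'b::euclidean_space \<Rightarrow> real"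
  assumes fin: "finite A" "finite E" and disj: "A \<inter> E = {}" and sub: "B \<subseteq> A"
    and der: "\<And>i w. i \<in> A \<union> E \<Longrightarrow> (g i has_derivative (\<lambda>d. G i w \<bullet> d)) (at w)"
    and z: "\<forall>i\<in>A. g i z \<le> 0" "\<forall>i\<in>E. g i z = 0"
    and proj: "\<And>w. \<forall>i\<in>A. g i w \<le> 0 \<Longrightarrow> \<forall>i\<in>E. g i w = 0 \<Longrightarrow> dist y z \<le> dist y w"
    and mult: "\<forall>\<^sub>F w in nhds z. \<forall>a. (\<forall>i\<in>B. 0 \<le> a i) \<longrightarrow>
       (\<exists>b. (\<forall>i\<in>B. 0 \<le> b i \<and> (0 < b i \<longrightarrow> 0 < a i))
          \<and> (\<Sum>i\<in>B \<union> E. b i *\<^sub>R G i w) = (\<Sum>i\<in>B \<union> E. a i *\<^sub>R G i w)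
          \<and> (\<Sum>i\<in>B \<union> E. \<bar>b i\<bar>) \<le> M * norm (\<Sum>i\<in>B \<union> E. a i *\<^sub>R G i w))"
    and inact: "\<forall>\<^sub>F w in nhds z. \<forall>i\<in>A - B. g i w \<le> 0"
    and lin: "\<forall>\<^sub>F w in nhds z. (\<forall>i\<in>B. G i w \<bullet> (y - w) \<le> g i y - g i w + \<epsilon> * norm (y - w))
       \<and> (\<forall>i\<in>E. \<bar>G i w \<bullet> (y - w) - (g i y - g i w)\<bar> \<le> \<epsilon> * norm (y - w))"
    and r: "\<forall>i\<in>B. g i y \<le> r" "\<forall>i\<in>E. \<bar>g i y\<bar> \<le> r"
    and nonneg: "M \<ge> 0" "\<epsilon> \<ge> 0" "r \<ge> 0"
  shows "norm (y - z) \<le> M * (r + \<epsilon> * norm (y - z))"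
proof -
  define v where "v = (\<lambda>w. (y - w) + (z - w))"
  \<comment> \<open>Violated inequalities have a favourable sign at \<open>w\<close>, equalities
    have none; their values at \<open>w\<close> are carried as an error that vanishes at
    \<open>z\<close>.\<close>
  define \<eta> where "\<eta> = (\<lambda>w. \<Sum>i\<in>E. \<bar>g i w\<bar>)"
  define C where "C = {w. v w \<bullet> (y - w) \<le> M * norm (v w) * (r + \<eta> w + \<epsilon> * norm (y - w))}"
  have contg: "continuous_on UNIV (g i)" if "i \<in> E" for i
    using der[of i] that by (meson UnI2 continuous_at_imp_continuous_on has_derivative_continuous)
  have "closed C"
    unfolding C_def v_def \<eta>_def by (intro closed_Collect_le continuous_intros contg) auto
  from eventually_conj[OF mult eventually_conj[OF inact lin]]
  obtain \<delta> where \<delta>: "\<delta> > 0" and near: "\<forall>w. dist w z < \<delta> \<longrightarrow>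
      (\<forall>a. (\<forall>i\<in>B. 0 \<le> a i) \<longrightarrow>
       (\<exists>b. (\<forall>i\<in>B. 0 \<le> b i \<and> (0 < b i \<longrightarrow> 0 < a i))
          \<and> (\<Sum>i\<in>B \<union> E. b i *\<^sub>R G i w) = (\<Sum>i\<in>B \<union> E. a i *\<^sub>R G i w)
          \<and> (\<Sum>i\<in>B \<union> E. \<bar>b i\<bar>) \<le> M * norm (\<Sum>i\<in>B \<union> E. a i *\<^sub>R G i w)))
      \<and> (\<forall>i\<in>A - B. g i w \<le> 0)
      \<and> (\<forall>i\<in>B. G i w \<bullet> (y - w) \<le> g i y - g i w + \<epsilon> * norm (y - w))
       \<and> (\<forall>i\<in>E. \<bar>G i w \<bullet> (y - w) - (g i y - g i w)\<bar> \<le> \<epsilon> * norm (y - w))"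
    unfolding eventually_nhds_metric by (elim exE conjE) (rule that; assumption)
  have "\<exists>w\<in>C. dist w z < e" if e: "e > 0" for e
  proof -
    have "min e \<delta> > 0" using e \<delta> by simp
    from approximate_KKT_projection[OF fin disj der z proj this]
    obtain w a where w: "dist w z < min e \<delta>" "\<forall>i\<in>A. 0 \<le> a i \<and> (0 < a i \<longrightarrow> 0 < g i w)"
      "v w = (\<Sum>i\<in>A \<union> E. a i *\<^sub>R G i w)" unfolding v_def by blast
    from w(1) have "dist w z < \<delta>" by simp
    note near_w = mp[OF spec[OF near] this]
    note nw = conjunct1[OF near_w] and iw = conjunct1[OF conjunct2[OF near_w]]
      and lw = conjunct1[OF conjunct2[OF conjunct2[OF near_w]]] conjunct2[OF conjunct2[OF conjunct2[OF near_w]]]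
    \<comment> \<open>Only violated constraints carry weight, and those outside \<open>B\<close> are
      not violated near \<open>z\<close>.\<close>
    have "a i = 0" if "i \<in> A - B" for i using w(2) iw that by force
    then have "(\<Sum>i\<in>B \<union> E. a i *\<^sub>R G i w) = (\<Sum>i\<in>A \<union> E. a i *\<^sub>R G i w)"
      using fin sub by (intro sum.mono_neutral_left) auto
    with w(3) have va: "v w = (\<Sum>i\<in>B \<union> E. a i *\<^sub>R G i w)" by simp
    have "\<forall>i\<in>B. 0 \<le> a i" using w(2) sub by auto
    from mp[OF spec[OF nw] this] obtain b where b: "\<forall>i\<in>B. 0 \<le> b i \<and> (0 < b i \<longrightarrow> 0 < a i)"
      "(\<Sum>i\<in>B \<union> E. b i *\<^sub>R G i w) = v w" "(\<Sum>i\<in>B \<union> E. \<bar>b i\<bar>) \<le> M * norm (v w)"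
      unfolding va by blast
    have \<eta>0: "\<eta> w \<ge> 0" unfolding \<eta>_def by (simp add: sum_nonneg)
    let ?R = "r + \<eta> w + \<epsilon> * norm (y - w)"
    have R0: "?R \<ge> 0" using nonneg \<eta>0 by simp
    have summand: "b i * (G i w \<bullet> (y - w)) \<le> \<bar>b i\<bar> * ?R" if "i \<in> B \<union> E" for i
    proof (cases "i \<in> B")
      case True
      show ?thesis
      proof (cases "b i = 0")
        case False
        then have "b i > 0" "g i w > 0" using b(1) w(2) True sub by (force simp: less_le)+
        moreover have "g i y \<le> r" "G i w \<bullet> (y - w) \<le> g i y - g i w + \<epsilon> * norm (y - w)"
          using r lw True by auto
        ultimately have "G i w \<bullet> (y - w) \<le> ?R" using \<eta>0 by linarith
        with \<open>b i > 0\<close> show ?thesis by simp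
      qed simp
    next
      case False
      with that have i: "i \<in> E" by simp
      then have "\<bar>g i w\<bar> \<le> \<eta> w" unfolding \<eta>_def using fin by (intro member_le_sum) auto
      moreover have "\<bar>g i y\<bar> \<le> r" "\<bar>G i w \<bullet> (y - w) - (g i y - g i w)\<bar> \<le> \<epsilon> * norm (y - w)"
        using r lw i by auto
      ultimately have "\<bar>G i w \<bullet> (y - w)\<bar> \<le> ?R" by linarith
      then have "\<bar>b i\<bar> * \<bar>G i w \<bullet> (y - w)\<bar> \<le> \<bar>b i\<bar> * ?R" by (intro mult_left_mono) auto
      then show ?thesis by (simp add: abs_mult[symmetric])
    qed
    have "v w \<bullet> (y - w) = (\<Sum>i\<in>B \<union> E. b i * (G i w \<bullet> (y - w)))"
      by (simp add: b(2)[symmetric] inner_sum_left)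
    also have "\<dots> \<le> (\<Sum>i\<in>B \<union> E. \<bar>b i\<bar> * ?R)" by (intro sum_mono summand)
    also have "\<dots> = (\<Sum>i\<in>B \<union> E. \<bar>b i\<bar>) * ?R" by (rule sum_distrib_right[symmetric])
    also have "\<dots> \<le> M * norm (v w) * ?R" using b(3) R0 by (intro mult_right_mono)
    finally have "w \<in> C" by (simp add: C_def)
    with w(1) show ?thesis by auto
  qed
  then have "z \<in> C" using \<open>closed C\<close> closed_approachable by blast
  moreover have "\<eta> z = 0" using z by (simp add: \<eta>_def)
  ultimately have "(y - z) \<bullet> (y - z) \<le> M * norm (y - z) * (r + \<epsilon> * norm (y - z))"
    by (simp add: C_def v_def)
  then have "norm (y - z) * norm (y - z) \<le> norm (y - z) * (M * (r + \<epsilon> * norm (y - z)))"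
    unfolding power2_norm_eq_inner[symmetric] power2_eq_square by (simp only: mult_ac)
  then show ?thesis
  proof (cases "norm (y - z) = 0")
    case True
    then show ?thesis using nonneg by simp
  next
    case False
    then have "norm (y - z) > 0" by simp
    with \<open>norm (y - z) * norm (y - z) \<le> _\<close> show ?thesis by (rule mult_left_le_imp_le)
  qed
qed

section \<open>Parametric constraint systems\<close>

lemma eventually_nhds_Pair_iff_box:
  fixes a :: "'a::metric_space" and b :: "'b::metric_space"
  shows "(\<forall>\<^sub>F z in nhds (a, b). P z) \<longleftrightarrow>
    (\<exists>\<rho>>0. \<forall>x y. dist x a < \<rho> \<longrightarrow> dist y b < \<rho> \<longrightarrow> P (x, y))"
proof
  assume "\<forall>\<^sub>F z in nhds (a, b). P z"
  then obtain d where d: "d > 0" "\<forall>z. dist z (a, b) < d \<longrightarrow> P z"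
    unfolding eventually_nhds_metric by blast
  have "P (x, y)" if "dist x a < d/2" "dist y b < d/2" for x y
  proof -
    have "dist (x, y) (a, b) \<le> dist x a + dist y b"
      unfolding dist_Pair_Pair by (rule sqrt_sum_squares_le_sum) auto
    with that d show ?thesis by auto
  qed
  with d(1) show "\<exists>\<rho>>0. \<forall>x y. dist x a < \<rho> \<longrightarrow> dist y b < \<rho> \<longrightarrow> P (x, y)"
    by (intro exI[of _ "d/2"]) auto
next
  assume "\<exists>\<rho>>0. \<forall>x y. dist x a < \<rho> \<longrightarrow> dist y b < \<rho> \<longrightarrow> P (x, y)"
  then obtain \<rho> where \<rho>: "\<rho> > 0" "\<forall>x y. dist x a < \<rho> \<longrightarrow> dist y b < \<rho> \<longrightarrow> P (x, y)" by blast
  show "\<forall>\<^sub>F z in nhds (a, b). P z"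
    unfolding eventually_nhds_metric
  proof (intro exI[of _ \<rho>] conjI allI impI)
    fix z assume "dist z (a, b) < \<rho>"
    then have "dist (fst z) a < \<rho>" "dist (snd z) b < \<rho>"
      using dist_fst_le[of z "(a, b)"] dist_snd_le[of z "(a, b)"] by auto
    with \<rho>(2) have "P (fst z, snd z)" by blast
    then show "P z" by simp
  qed (rule \<rho>(1))
qed

text \<open>Restriction to the line through \<open>w\<close> and \<open>y\<close> reduces this to
  the tangent inequality in one variable.\<close>

lemma convex_on_gradient_le:
  fixes g :: "'b::real_inner \<Rightarrow> real"
  assumes cvx: "convex_on UNIV g" and der: "(g has_derivative (\<lambda>d. G \<bullet> d)) (at w)"
  shows "G \<bullet> (y - w) \<le> g y - g w"
proof -
  let ?\<phi> = "\<lambda>t::real. g (w + t *\<^sub>R (y - w))"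
  have "convex_on UNIV ?\<phi>"
    unfolding convex_on_def
  proof (intro conjI ballI allI impI)
    fix s t u v :: real assume uv: "0 \<le> u" "0 \<le> v" "u + v = 1"
    have "w + (u *\<^sub>R s + v *\<^sub>R t) *\<^sub>R (y - w) = (u + v) *\<^sub>R w + (u *\<^sub>R s + v *\<^sub>R t) *\<^sub>R (y - w)"
      using uv by simp
    also have "\<dots> = u *\<^sub>R (w + s *\<^sub>R (y - w)) + v *\<^sub>R (w + t *\<^sub>R (y - w))"
      by (simp add: algebra_simps)
    finally show "?\<phi> (u *\<^sub>R s + v *\<^sub>R t) \<le> u * ?\<phi> s + v * ?\<phi> t"
      using cvx uv unfolding convex_on_def by (metis UNIV_I)
  qed simp
  moreover have "((\<lambda>t::real. w + t *\<^sub>R (y - w)) has_derivative (\<lambda>t. t *\<^sub>R (y - w))) (at 0)"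
    by (auto intro!: derivative_eq_intros)
  from has_derivative_compose[OF this, of g "\<lambda>d. G \<bullet> d"] der
  have "(?\<phi> has_field_derivative G \<bullet> (y - w)) (at 0)"
    by (simp add: has_field_derivative_def mult.commute[of _ "G \<bullet> (y - w)"])
  ultimately have "(G \<bullet> (y - w)) * (1 - 0) \<le> ?\<phi> 1 - ?\<phi> 0"
    by (intro convex_on_imp_above_tangent[of UNIV]) auto
  then show ?thesis by simp
qed

text \<open>The right-hand side \<open>c\<close> depends on \<open>x\<close> only and carries no
  assumption here, so that the value function can be substituted for it. Continuity or Lipschitz
  continuity of \<open>c\<close> is requested only by the lemmas that let \<open>x\<close>
  vary.\<close>

locale parametric_system =
  fixes F :: "nat \<Rightarrow> 'a::euclidean_space \<times> 'b::euclidean_space \<Rightarrow> real"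
    and G :: "nat \<Rightarrow> 'a \<times> 'b \<Rightarrow> 'b" and c :: "nat \<Rightarrow> 'a \<Rightarrow> real" and A E :: "nat set"
  assumes finite_A: "finite A" and finite_E: "finite E" and disjoint: "A \<inter> E = {}"
    and der: "\<And>i x y. i \<in> A \<union> E \<Longrightarrow> ((\<lambda>y. F i (x, y)) has_derivative (\<lambda>d. G i (x, y) \<bullet> d)) (at y)"
    and cont_F: "\<And>i. i \<in> A \<union> E \<Longrightarrow> continuous_on UNIV (F i)"
    and cont_G: "\<And>i. i \<in> A \<union> E \<Longrightarrow> continuous_on UNIV (G i)"
begin

definition feas :: "'a \<Rightarrow> 'b set" where
  "feas x = {y. (\<forall>i\<in>A. F i (x, y) \<le> c i x) \<and> (\<forall>i\<in>E. F i (x, y) = c i x)}"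

lemma closed_feas: "closed (feas x)"
proof -
  have cy: "continuous_on UNIV (\<lambda>y. F i (x, y))" if "i \<in> A \<union> E" for i
    using der[OF that] by (meson continuous_at_imp_continuous_on has_derivative_continuous)
  have "feas x = (\<Inter>i\<in>A. {y. F i (x, y) \<le> c i x}) \<inter> (\<Inter>i\<in>E. {y. F i (x, y) = c i x})"
    unfolding feas_def by auto
  also have "closed \<dots>"
    by (intro closed_Int closed_INT ballI closed_Collect_le closed_Collect_eq
        continuous_on_const cy) auto
  finally show ?thesis .
qed

text \<open>On a small box every gradient is within e/2 of the reference gradient, so gradients
  along the segment from \<open>w\<close> to \<open>y\<close> differ from the one at
  \<open>w\<close> by at most e; the mean value inequality concludes.\<close>

lemma linearization_error:
  assumes i: "i \<in> A \<union> E" and e: "e > 0"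
  shows "\<exists>\<rho>>0. \<forall>x y w. dist x xb < \<rho> \<longrightarrow> dist y yb < \<rho> \<longrightarrow> dist w yb < \<rho> \<longrightarrow>
    \<bar>G i (x, w) \<bullet> (y - w) - (F i (x, y) - F i (x, w))\<bar> \<le> e * norm (y - w)"
proof -
  have "(G i \<longlongrightarrow> G i (xb, yb)) (nhds (xb, yb))"
    using cont_G[OF i] continuous_on_eq_continuous_at[OF open_UNIV, of "G i"]
    by (auto simp: continuous_at tendsto_at_iff_tendsto_nhds)
  then have "\<forall>\<^sub>F z in nhds (xb, yb). dist (G i z) (G i (xb, yb)) < e/2"
    using e by (intro tendstoD) auto
  then obtain \<rho> where \<rho>: "\<rho> > 0"
    and near: "\<And>x y. dist x xb < \<rho> \<Longrightarrow> dist y yb < \<rho> \<Longrightarrow> dist (G i (x, y)) (G i (xb, yb)) < e/2"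
    unfolding eventually_nhds_Pair_iff_box by blast
  have "\<bar>G i (x, w) \<bullet> (y - w) - (F i (x, y) - F i (x, w))\<bar> \<le> e * norm (y - w)"
    if x: "dist x xb < \<rho>" and y: "dist y yb < \<rho>" and w: "dist w yb < \<rho>" for x y w
  proof -
    have "norm (F i (x, y) - F i (x, w) - G i (x, w) \<bullet> (y - w)) \<le> norm (y - w) * e"
    proof (rule differentiable_bound_linearization
        [where f = "\<lambda>u. F i (x, u)" and f' = "\<lambda>u d. G i (x, u) \<bullet> d" and S = "ball yb \<rho>"])
      fix t :: real assume t: "t \<in> {0..1}"
      have "(1 - t) *\<^sub>R w + t *\<^sub>R y \<in> ball yb \<rho>"
        using convexD[OF convex_ball, of w yb \<rho> y "1 - t" t] t y w by (auto simp: dist_commute)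
      then show "w + t *\<^sub>R (y - w) \<in> ball yb \<rho>" by (simp add: algebra_simps)
    next
      fix u show "((\<lambda>u. F i (x, u)) has_derivative (\<lambda>d. G i (x, u) \<bullet> d)) (at u within ball yb \<rho>)"
        by (rule has_derivative_at_withinI[OF der[OF i]])
    next
      fix u assume "u \<in> ball yb \<rho>"
      then have "dist (G i (x, u)) (G i (xb, yb)) < e/2"
        using x by (intro near) (auto simp: dist_commute)
      moreover have "dist (G i (x, w)) (G i (xb, yb)) < e/2" by (rule near[OF x w])
      ultimately have "norm (G i (x, u) - G i (x, w)) \<le> e"
        unfolding dist_norm[symmetric] using dist_triangle2[of "G i (x, u)" "G i (x, w)" "G i (xb, yb)"]
        by linarith
      moreover have "norm ((G i (x, u) - G i (x, w)) \<bullet> d) \<le> norm (G i (x, u) - G i (x, w)) * norm d" for d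
        by (simp add: Cauchy_Schwarz_ineq2)
      ultimately have "norm ((G i (x, u) - G i (x, w)) \<bullet> d) \<le> e * norm d" for d
        by (meson mult_right_mono norm_ge_zero order_trans)
      then have "onorm (\<lambda>d. (G i (x, u) - G i (x, w)) \<bullet> d) \<le> e"
        by (intro onorm_le)
      then show "onorm ((\<lambda>d. G i (x, u) \<bullet> d) - (\<lambda>d. G i (x, w) \<bullet> d)) \<le> e"
        by (simp add: fun_diff_def inner_diff_left)
    qed (use w in \<open>auto simp: dist_commute\<close>)
    then show ?thesis by (simp add: abs_minus_commute mult.commute)
  qed
  with \<rho> show ?thesis by blast
qed

text \<open>\<open>M\<close> and \<open>\<rho>\<close> depend on the reference point alone. Only
  \<open>x\<close> and the projection \<open>z\<close> have to be near it, while \<open>y\<close>,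
  the error \<open>e\<close> and the residual bound \<open>r\<close> are free.\<close>

lemma local_projection_bound:
  assumes sub: "B \<subseteq> A" and rc: "rcpld G B E (xb, yb)"
    and inact: "\<forall>i\<in>A - B. \<forall>\<^sub>F z in nhds (xb, yb). F i z \<le> c i (fst z)"
  shows "\<exists>M>0. \<exists>\<rho>>0. \<forall>x y z e r. dist x xb < \<rho> \<longrightarrow> dist z yb < \<rho> \<longrightarrow> z \<in> feas x \<longrightarrow>
      (\<forall>w\<in>feas x. dist y z \<le> dist y w) \<longrightarrow> 0 \<le> e \<longrightarrow> 0 \<le> r \<longrightarrow>
      (\<forall>i\<in>B. F i (x, y) - c i x \<le> r) \<longrightarrow> (\<forall>i\<in>E. \<bar>F i (x, y) - c i x\<bar> \<le> r) \<longrightarrow>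
      (\<forall>\<^sub>F w in nhds z. (\<forall>i\<in>B. G i (x, w) \<bullet> (y - w) \<le> F i (x, y) - F i (x, w) + e * norm (y - w))
         \<and> (\<forall>i\<in>E. \<bar>G i (x, w) \<bullet> (y - w) - (F i (x, y) - F i (x, w))\<bar> \<le> e * norm (y - w))) \<longrightarrow>
      norm (y - z) \<le> M * (r + e * norm (y - z))"
proof -
  let ?mult = "\<lambda>M z. \<forall>a. (\<forall>i\<in>B. 0 \<le> a i) \<longrightarrow>
       (\<exists>b. (\<forall>i\<in>B. 0 \<le> b i \<and> (0 < b i \<longrightarrow> 0 < a i))
          \<and> (\<Sum>i\<in>B \<union> E. b i *\<^sub>R G i z) = (\<Sum>i\<in>B \<union> E. a i *\<^sub>R G i z)
          \<and> (\<Sum>i\<in>B \<union> E. \<bar>b i\<bar>) \<le> M * norm (\<Sum>i\<in>B \<union> E. a i *\<^sub>R G i z))"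
  have finB: "finite B" using sub finite_A finite_subset by auto
  have BE: "B \<inter> E = {}" using sub disjoint by auto
  have contB: "continuous_on UNIV (G i)" if "i \<in> B \<union> E" for i using that sub cont_G by blast
  obtain M where M: "M > 0" and mult: "\<forall>\<^sub>F z in nhds (xb, yb). ?mult M z"
    by (rule rcpld_bounded_multipliers[OF rc finB finite_E BE contB])
  have "\<forall>\<^sub>F z in nhds (xb, yb). \<forall>i\<in>A - B. F i z \<le> c i (fst z)"
    using inact finite_A by (intro eventually_ball_finite) auto
  from eventually_conj[OF mult this] obtain \<rho> where \<rho>: "\<rho> > 0" and
    near: "\<forall>x y. dist x xb < \<rho> \<longrightarrow> dist y yb < \<rho> \<longrightarrow>
      ?mult M (x, y) \<and> (\<forall>i\<in>A - B. F i (x, y) \<le> c i (fst (x, y)))"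
    unfolding eventually_nhds_Pair_iff_box by (elim exE conjE) (rule that; assumption)
  show ?thesis
  proof (intro exI conjI allI impI)
    show "M > 0" by (rule M)
    show "\<rho> > 0" by (rule \<rho>)
    fix x y z e and r :: real
    assume x: "dist x xb < \<rho>" and z: "dist z yb < \<rho>" "z \<in> feas x"
      and proj: "\<forall>w\<in>feas x. dist y z \<le> dist y w" and e: "0 \<le> e" and r: "0 \<le> r"
      and res: "\<forall>i\<in>B. F i (x, y) - c i x \<le> r" "\<forall>i\<in>E. \<bar>F i (x, y) - c i x\<bar> \<le> r"
      and lin: "\<forall>\<^sub>F w in nhds z. (\<forall>i\<in>B. G i (x, w) \<bullet> (y - w) \<le> F i (x, y) - F i (x, w) + e * norm (y - w))
         \<and> (\<forall>i\<in>E. \<bar>G i (x, w) \<bullet> (y - w) - (F i (x, y) - F i (x, w))\<bar> \<le> e * norm (y - w))"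
    have "open (ball yb \<rho>)" "z \<in> ball yb \<rho>" using z by (auto simp: dist_commute)
    then have ev: "\<forall>\<^sub>F w in nhds z. dist w yb < \<rho>"
      by (metis (no_types, lifting) dist_commute eventually_mono eventually_nhds_in_open mem_ball)
    show "norm (y - z) \<le> M * (r + e * norm (y - z))"
    proof (rule projection_distance_estimate[where g = "\<lambda>i w. F i (x, w) - c i x"
          and G = "\<lambda>i w. G i (x, w)" and A = A and B = B and E = E])
      show "((\<lambda>w. F i (x, w) - c i x) has_derivative (\<lambda>d. G i (x, w) \<bullet> d)) (at w)"
        if "i \<in> A \<union> E" for i w
        using has_derivative_diff[OF der[OF that] has_derivative_const] by simp
      show "\<forall>\<^sub>F w in nhds z. ?mult M (x, w)"
        by (rule eventually_mono[OF ev]) (rule conjunct1[OF near[THEN spec, THEN spec, THEN mp, THEN mp, OF x]])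
      show "\<forall>\<^sub>F w in nhds z. \<forall>i\<in>A - B. F i (x, w) - c i x \<le> 0"
        by (rule eventually_mono[OF ev])
          (use conjunct2[OF near[THEN spec, THEN spec, THEN mp, THEN mp, OF x]] in auto)
      show "dist y z \<le> dist y w"
        if "\<forall>i\<in>A. F i (x, w) - c i x \<le> 0" "\<forall>i\<in>E. F i (x, w) - c i x = 0" for w
        using that proj by (auto simp: feas_def)
      show "\<forall>\<^sub>F w in nhds z.
          (\<forall>i\<in>B. G i (x, w) \<bullet> (y - w) \<le> F i (x, y) - c i x - (F i (x, w) - c i x) + e * norm (y - w)) \<and>
          (\<forall>i\<in>E. \<bar>G i (x, w) \<bullet> (y - w) - (F i (x, y) - c i x - (F i (x, w) - c i x))\<bar> \<le> e * norm (y - w))"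
        using lin by simp
    qed (use finite_A finite_E disjoint sub z res e r M in \<open>auto simp: feas_def\<close>)
  qed
qed

text \<open>A feasible point near \<open>yb\<close> guarantees that the projection of
  \<open>y\<close> exists and stays in the box where the multiplier bound holds. Stating the result
  for every admissible \<open>r\<close> lets it be used both with the maximal residual and with a
  Lipschitz estimate.\<close>

lemma error_bound:
  assumes sub: "B \<subseteq> A" and rc: "rcpld G B E (xb, yb)"
    and inact: "\<forall>i\<in>A - B. \<forall>\<^sub>F z in nhds (xb, yb). F i z \<le> c i (fst z)"
    and isc: "\<And>e. e > 0 \<Longrightarrow> \<forall>\<^sub>F x in nhds xb. \<exists>y\<in>feas x. dist y yb < e"
  obtains \<kappa> where "\<kappa> > 0"
    "\<forall>\<^sub>F z in nhds (xb, yb). \<forall>r\<ge>0. (\<forall>i\<in>A. F i z - c i (fst z) \<le> r) \<longrightarrow>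
       (\<forall>i\<in>E. \<bar>F i z - c i (fst z)\<bar> \<le> r) \<longrightarrow> (\<exists>w\<in>feas (fst z). dist (snd z) w \<le> \<kappa> * r)"
proof -
  obtain M \<rho> where M: "M > 0" and \<rho>: "\<rho> > 0" and bound: "\<forall>x y z e r. dist x xb < \<rho> \<longrightarrow> dist z yb < \<rho> \<longrightarrow> z \<in> feas x \<longrightarrow>
      (\<forall>w\<in>feas x. dist y z \<le> dist y w) \<longrightarrow> 0 \<le> e \<longrightarrow> 0 \<le> r \<longrightarrow>
      (\<forall>i\<in>B. F i (x, y) - c i x \<le> r) \<longrightarrow> (\<forall>i\<in>E. \<bar>F i (x, y) - c i x\<bar> \<le> r) \<longrightarrow>
      (\<forall>\<^sub>F w in nhds z. (\<forall>i\<in>B. G i (x, w) \<bullet> (y - w) \<le> F i (x, y) - F i (x, w) + e * norm (y - w))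
         \<and> (\<forall>i\<in>E. \<bar>G i (x, w) \<bullet> (y - w) - (F i (x, y) - F i (x, w))\<bar> \<le> e * norm (y - w))) \<longrightarrow>
      norm (y - z) \<le> M * (r + e * norm (y - z))"
    using local_projection_bound[OF sub rc inact] by (elim exE conjE) (rule that; assumption)
  \<comment> \<open>This makes \<open>M * e = 1/2\<close>, so the error term is absorbed on the left
    and the modulus becomes \<open>2 * M\<close>.\<close>
  define e where "e = 1 / (2 * M)"
  have e: "e > 0" using M by (simp add: e_def)
  define Q where "Q = (\<lambda>i s. \<forall>x y w. dist x xb < s \<longrightarrow> dist y yb < s \<longrightarrow> dist w yb < s \<longrightarrow>
    \<bar>G i (x, w) \<bullet> (y - w) - (F i (x, y) - F i (x, w))\<bar> \<le> e * norm (y - w))"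
  have "\<forall>i\<in>A \<union> E. \<exists>s>0. Q i s"
    unfolding Q_def by (intro ballI linearization_error e)
  then obtain s where s: "\<And>i. i \<in> A \<union> E \<Longrightarrow> s i > 0" "\<And>i. i \<in> A \<union> E \<Longrightarrow> Q i (s i)"
    by metis
  have lin: "\<bar>G i (x, w) \<bullet> (y - w) - (F i (x, y) - F i (x, w))\<bar> \<le> e * norm (y - w)"
    if "i \<in> A \<union> E" "dist x xb < s i" "dist y yb < s i" "dist w yb < s i" for i x y w
    using s(2)[OF that(1)] that unfolding Q_def by blast
  define \<sigma> where "\<sigma> = Min (insert \<rho> (s ` (A \<union> E)))"
  have \<sigma>: "\<sigma> > 0" "\<sigma> \<le> \<rho>" "\<And>i. i \<in> A \<union> E \<Longrightarrow> \<sigma> \<le> s i"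
    using \<rho> s(1) finite_A finite_E by (auto simp: \<sigma>_def)
  \<comment> \<open>With \<open>y\<close> and the feasible point both within a quarter of
    \<open>\<sigma>\<close> of \<open>yb\<close>, the projection is less than half of
    \<open>\<sigma>\<close> from \<open>y\<close>, hence within \<open>\<sigma>\<close> of
    \<open>yb\<close>.\<close>
  have "\<forall>\<^sub>F x in nhds xb. \<exists>y\<in>feas x. dist y yb < \<sigma>/4" using \<sigma> by (intro isc) auto
  then obtain d where d: "d > 0" and isd: "\<And>x. dist x xb < d \<Longrightarrow> \<exists>y\<in>feas x. dist y yb < \<sigma>/4"
    unfolding eventually_nhds_metric by blast
  have "\<exists>w\<in>feas x. dist y w \<le> (2 * M) * r"
    if x: "dist x xb < min d (\<sigma>/4)" and y: "dist y yb < min d (\<sigma>/4)" and r: "r \<ge> 0"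
      and res: "\<forall>i\<in>A. F i (x, y) - c i x \<le> r" "\<forall>i\<in>E. \<bar>F i (x, y) - c i x\<bar> \<le> r" for x y r
  proof -
    obtain y0 where y0: "y0 \<in> feas x" "dist y0 yb < \<sigma>/4" using isd x by auto
    then have ne: "feas x \<noteq> {}" by auto
    obtain z where z: "z \<in> feas x" "\<And>w. w \<in> feas x \<Longrightarrow> dist y z \<le> dist y w"
      using distance_attains_inf[OF closed_feas ne] by blast
    have "dist y z \<le> dist y y0" using z y0 by auto
    also have "dist y y0 \<le> dist y yb + dist y0 yb" by (rule dist_triangle2)
    finally have "dist y z < \<sigma>/2" using y0 y by auto
    moreover have "dist z yb \<le> dist z y + dist y yb" by (rule dist_triangle)
    ultimately have zb: "dist z yb < \<sigma>" using y \<sigma> by (auto simp: dist_commute)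
    have "open (ball yb \<sigma>)" "z \<in> ball yb \<sigma>" using zb by (auto simp: dist_commute)
    then have ev: "\<forall>\<^sub>F w in nhds z. dist w yb < \<sigma>"
      by (metis (no_types, lifting) dist_commute eventually_mono eventually_nhds_in_open mem_ball)
    have "norm (y - z) \<le> M * (r + e * norm (y - z))"
    proof (rule bound[rule_format])
      show "\<forall>\<^sub>F w in nhds z. (\<forall>i\<in>B. G i (x, w) \<bullet> (y - w) \<le> F i (x, y) - F i (x, w) + e * norm (y - w))
         \<and> (\<forall>i\<in>E. \<bar>G i (x, w) \<bullet> (y - w) - (F i (x, y) - F i (x, w))\<bar> \<le> e * norm (y - w))"
      proof (rule eventually_mono[OF ev])
        fix w assume w: "dist w yb < \<sigma>"
        have l: "\<bar>G i (x, w) \<bullet> (y - w) - (F i (x, y) - F i (x, w))\<bar> \<le> e * norm (y - w)"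
          if i: "i \<in> A \<union> E" for i
          using \<sigma>(1) \<sigma>(3)[OF i] x y w by (intro lin[OF i]) auto
        show "(\<forall>i\<in>B. G i (x, w) \<bullet> (y - w) \<le> F i (x, y) - F i (x, w) + e * norm (y - w))
         \<and> (\<forall>i\<in>E. \<bar>G i (x, w) \<bullet> (y - w) - (F i (x, y) - F i (x, w))\<bar> \<le> e * norm (y - w))"
        proof (intro conjI ballI)
          fix i assume "i \<in> B"
          then show "G i (x, w) \<bullet> (y - w) \<le> F i (x, y) - F i (x, w) + e * norm (y - w)"
            using l[of i] sub by auto
        qed (use l in auto)
      qed
    qed (use x zb z e r res sub \<sigma> in auto)
    then have "norm (y - z) \<le> 2 * M * r" using M by (simp add: e_def field_simps)
    then show ?thesis using z by (auto simp: dist_norm)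
  qed
  then have "\<forall>\<^sub>F z in nhds (xb, yb). \<forall>r\<ge>0. (\<forall>i\<in>A. F i z - c i (fst z) \<le> r) \<longrightarrow>
       (\<forall>i\<in>E. \<bar>F i z - c i (fst z)\<bar> \<le> r) \<longrightarrow> (\<exists>w\<in>feas (fst z). dist (snd z) w \<le> (2 * M) * r)"
    unfolding eventually_nhds_Pair_iff_box using d \<sigma>
    by (intro exI[of _ "min d (\<sigma>/4)"] conjI allI impI) (auto simp del: min_less_iff_conj)
  then show ?thesis using M by (intro that[of "2 * M"]) auto
qed

end

section \<open>Inner semicontinuity and the Aubin property\<close>

text \<open>Convexity of both g and -g turns the tangent inequality into an equality, so equality
  constraints have linearisation error 0.\<close>

lemma affine_fun_imp_convex_on:
  assumes "affine_fun g"
  shows "convex_on UNIV g" "convex_on UNIV (\<lambda>y. - g y)"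
proof -
  obtain a c where g: "\<And>y. g y = a \<bullet> y + c" using assms unfolding affine_fun_def by blast
  have *: "g (u *\<^sub>R y + v *\<^sub>R z) = u * g y + v * g z" if "u + v = 1" for u v y z
  proof -
    have "g (u *\<^sub>R y + v *\<^sub>R z) = u * (a \<bullet> y) + v * (a \<bullet> z) + (u + v) * c"
      using that by (simp add: g inner_add_right)
    then show ?thesis by (simp add: g algebra_simps)
  qed
  show "convex_on UNIV g" "convex_on UNIV (\<lambda>y. - g y)"
    unfolding convex_on_def by (auto simp: *)
qed

lemma locally_lipschitz_family:
  assumes "finite I" "\<forall>i\<in>I. \<exists>\<rho>>0. \<exists>L. L-lipschitz_on (ball z \<rho>) (f i)"
  shows "\<exists>\<rho>>0. \<exists>L. \<forall>i\<in>I. L-lipschitz_on (ball z \<rho>) (f i)"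
  using assms
proof (induction I rule: finite_induct)
  case empty
  then show ?case by (auto intro: exI[of _ 1])
next
  case (insert j I)
  then obtain \<rho> L where 1: "\<rho> > 0" "\<forall>i\<in>I. L-lipschitz_on (ball z \<rho>) (f i)" by auto
  obtain \<sigma> K where 2: "\<sigma> > 0" "K-lipschitz_on (ball z \<sigma>) (f j)" using insert.prems by auto
  have "\<forall>i\<in>insert j I. (max L K)-lipschitz_on (ball z (min \<rho> \<sigma>)) (f i)"
  proof
    fix i assume "i \<in> insert j I"
    then consider "i = j" | "i \<in> I" by blast
    then show "(max L K)-lipschitz_on (ball z (min \<rho> \<sigma>)) (f i)"
    proof cases
      case 1
      show ?thesis unfolding 1
        by (rule lipschitz_on_mono[OF 2(2)]) auto
    next
      case i: 2
      show ?thesis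
        by (rule lipschitz_on_mono[of L "ball z \<rho>"]) (use 1(2) i in auto)
    qed
  qed
  moreover have "min \<rho> \<sigma> > 0" using 1 2 by simp
  ultimately show ?case by blast
qed

context parametric_system
begin

text \<open>In the convex case the linearisation error has a sign, so the projection of \<open>yb\<close> onto
  \<open>feas x\<close> obeys the error bound wherever it lies; compactness then provides a
  reference point at which the multipliers are bounded.\<close>

lemma convex_inner_semicontinuous:
  assumes cvx: "\<forall>i\<in>A. \<forall>x. convex_on UNIV (\<lambda>y. F i (x, y))"
    and aff: "\<forall>i\<in>E. \<forall>x. affine_fun (\<lambda>y. F i (x, y))"
    and cont_c: "\<forall>i\<in>A \<union> E. isCont (c i) xb"
    and bd: "bounded S" and loc: "\<forall>\<^sub>F x in nhds xb. feas x \<noteq> {} \<and> feas x \<subseteq> S"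
    and rc: "\<forall>z\<in>feas xb. \<exists>B\<subseteq>A. rcpld G B E (xb, z)
       \<and> (\<forall>i\<in>A - B. \<forall>\<^sub>F w in nhds (xb, z). F i w \<le> c i (fst w))"
    and yb: "yb \<in> feas xb" and e: "e > 0"
  shows "\<forall>\<^sub>F x in nhds xb. \<exists>y\<in>feas x. dist y yb < e"
proof (rule ccontr)
  assume "\<not> ?thesis"
  then have fr: "\<exists>\<^sub>F x in nhds xb. \<not> (\<exists>y\<in>feas x. dist y yb < e)"
    by (simp add: frequently_def)
  \<comment> \<open>A sequence along which feasible points exist and stay bounded, but keep away
    from \<open>yb\<close>.\<close>
  have "\<exists>x. dist x xb < inverse (real (Suc n)) \<and> feas x \<noteq> {} \<and> feas x \<subseteq> S
      \<and> (\<forall>y\<in>feas x. e \<le> dist y yb)" for n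
  proof -
    have "\<forall>\<^sub>F x in nhds xb. dist x xb < inverse (real (Suc n))"
      unfolding eventually_nhds_metric by (intro exI[of _ "inverse (real (Suc n))"]) auto
    from frequently_eventually_frequently[OF fr eventually_conj[OF this loc]]
    show ?thesis by (auto dest!: frequently_ex simp: not_less)
  qed
  then obtain X where X: "\<And>n. dist (X n) xb < inverse (real (Suc n))" "\<And>n. feas (X n) \<noteq> {}"
    "\<And>n. feas (X n) \<subseteq> S" "\<And>n y. y \<in> feas (X n) \<Longrightarrow> e \<le> dist y yb"
    by metis
  have limX: "X \<longlonglongrightarrow> xb"
    unfolding tendsto_dist_iff[of X]
    by (rule tendsto_sandwich[OF _ _ tendsto_const LIMSEQ_inverse_real_of_nat])
      (use X(1) in \<open>auto intro!: always_eventually less_imp_le\<close>)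
  have "\<exists>z\<in>feas (X n). \<forall>w\<in>feas (X n). dist yb z \<le> dist yb w" for n
    using distance_attains_inf[OF closed_feas X(2)] by metis
  then obtain Z where Z: "\<And>n. Z n \<in> feas (X n)"
    and proj: "\<And>n. \<forall>w\<in>feas (X n). dist yb (Z n) \<le> dist yb w"
    by metis
  have "bounded (range Z)"
    by (rule bounded_subset[OF bd]) (use Z X(3) in auto)
  then obtain zb r where r: "strict_mono r" and limZ: "(Z \<circ> r) \<longlonglongrightarrow> zb"
    using bounded_imp_convergent_subsequence by blast
  have limXr: "(X \<circ> r) \<longlonglongrightarrow> xb" by (rule LIMSEQ_subseq_LIMSEQ[OF limX r])
  have limF: "(\<lambda>n. F i ((X \<circ> r) n, (Z \<circ> r) n)) \<longlonglongrightarrow> F i (xb, zb)" if "i \<in> A \<union> E" for i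
    using cont_F[OF that]
    by (rule continuous_on_tendsto_compose[OF _ tendsto_Pair[OF limXr limZ]]) auto
  have limc: "(\<lambda>n. c i ((X \<circ> r) n)) \<longlonglongrightarrow> c i xb" if "i \<in> A \<union> E" for i
    using cont_c that by (intro isCont_tendsto_compose[OF _ limXr]) auto
  have Zr: "(Z \<circ> r) n \<in> feas ((X \<circ> r) n)" for n using Z by simp
  have zb: "zb \<in> feas xb"
    unfolding feas_def mem_Collect_eq
  proof (intro conjI ballI)
    fix i assume i: "i \<in> A"
    show "F i (xb, zb) \<le> c i xb"
      by (rule LIMSEQ_le[OF limF limc]) (use i Zr in \<open>auto simp: feas_def\<close>)
  next
    fix i assume i: "i \<in> E"
    have eq: "(\<lambda>n. F i ((X \<circ> r) n, (Z \<circ> r) n)) = (\<lambda>n. c i ((X \<circ> r) n))"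
      using Zr i by (auto simp: feas_def fun_eq_iff)
    have "(\<lambda>n. c i ((X \<circ> r) n)) \<longlonglongrightarrow> F i (xb, zb)"
      using limF[of i] i unfolding eq by simp
    then show "F i (xb, zb) = c i xb" using limc[of i] i by (blast intro: LIMSEQ_unique)
  qed
  \<comment> \<open>The multipliers are controlled at the cluster point \<open>zb\<close> of the
    projections, which may differ from \<open>yb\<close>; hence the qualification is assumed at
    every point of \<open>feas xb\<close>.\<close>
  obtain B where B: "B \<subseteq> A" "rcpld G B E (xb, zb)"
    "\<forall>i\<in>A - B. \<forall>\<^sub>F w in nhds (xb, zb). F i w \<le> c i (fst w)"
    using rc zb by blast
  obtain M \<rho> where M: "M > 0" and \<rho>: "\<rho> > 0" and bound: "\<forall>x y z e r. dist x xb < \<rho> \<longrightarrow> dist z zb < \<rho> \<longrightarrow> z \<in> feas x \<longrightarrow>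
      (\<forall>w\<in>feas x. dist y z \<le> dist y w) \<longrightarrow> 0 \<le> e \<longrightarrow> 0 \<le> r \<longrightarrow>
      (\<forall>i\<in>B. F i (x, y) - c i x \<le> r) \<longrightarrow> (\<forall>i\<in>E. \<bar>F i (x, y) - c i x\<bar> \<le> r) \<longrightarrow>
      (\<forall>\<^sub>F w in nhds z. (\<forall>i\<in>B. G i (x, w) \<bullet> (y - w) \<le> F i (x, y) - F i (x, w) + e * norm (y - w))
         \<and> (\<forall>i\<in>E. \<bar>G i (x, w) \<bullet> (y - w) - (F i (x, y) - F i (x, w))\<bar> \<le> e * norm (y - w))) \<longrightarrow>
      norm (y - z) \<le> M * (r + e * norm (y - z))"
    using local_projection_bound[OF B] by (elim exE conjE) (rule that; assumption)
  \<comment> \<open>A sum of violations of \<open>yb\<close> rather than a maximum: it bounds each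
    of them, vanishes at \<open>xb\<close>, and its convergence follows termwise from continuity of
    the \<open>F i\<close> and \<open>c i\<close>.\<close>
  define R where "R = (\<lambda>x. (\<Sum>i\<in>A. max 0 (F i (x, yb) - c i x)) + (\<Sum>i\<in>E. \<bar>F i (x, yb) - c i x\<bar>))"
  have limFy: "(\<lambda>n. F i ((X \<circ> r) n, yb)) \<longlonglongrightarrow> F i (xb, yb)" if "i \<in> A \<union> E" for i
    using cont_F[OF that]
    by (rule continuous_on_tendsto_compose[OF _ tendsto_Pair[OF limXr tendsto_const]]) auto
  have "(\<lambda>n. R ((X \<circ> r) n)) \<longlonglongrightarrow> R xb"
    unfolding R_def by (intro tendsto_intros limFy limc) auto
  also have "R xb = 0" using yb by (auto simp: R_def feas_def intro!: sum.neutral)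
  finally have "(\<lambda>n. M * R ((X \<circ> r) n)) \<longlonglongrightarrow> M * 0" by (intro tendsto_intros)
  then have "\<forall>\<^sub>F n in sequentially. M * R ((X \<circ> r) n) < e"
    by (rule order_tendstoD) (use e in simp)
  moreover have "\<forall>\<^sub>F n in sequentially. dist ((X \<circ> r) n) xb < \<rho>" "\<forall>\<^sub>F n in sequentially. dist ((Z \<circ> r) n) zb < \<rho>"
    using tendstoD[OF limXr \<rho>] tendstoD[OF limZ \<rho>] .
  ultimately have "\<forall>\<^sub>F n in sequentially. M * R ((X \<circ> r) n) < e \<and> dist ((X \<circ> r) n) xb < \<rho> \<and> dist ((Z \<circ> r) n) zb < \<rho>"
    by eventually_elim simp
  then obtain n where n: "M * R ((X \<circ> r) n) < e" "dist ((X \<circ> r) n) xb < \<rho>" "dist ((Z \<circ> r) n) zb < \<rho>"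
    using eventually_happens'[OF sequentially_bot] by blast
  define x z where "x = (X \<circ> r) n" and "z = (Z \<circ> r) n"
  have R0: "0 \<le> (\<Sum>i\<in>A. max 0 (F i (x, yb) - c i x))" "0 \<le> (\<Sum>i\<in>E. \<bar>F i (x, yb) - c i x\<bar>)"
    by (auto intro: sum_nonneg)
  \<comment> \<open>Convexity and affineness allow error 0 for the fixed point \<open>yb\<close>,
    however far it is from the projection \<open>z\<close>.\<close>
  have "norm (yb - z) \<le> M * (R x + 0 * norm (yb - z))"
  proof (rule bound[rule_format])
    show "\<forall>\<^sub>F w in nhds z. (\<forall>i\<in>B. G i (x, w) \<bullet> (yb - w) \<le> F i (x, yb) - F i (x, w) + 0 * norm (yb - w))
         \<and> (\<forall>i\<in>E. \<bar>G i (x, w) \<bullet> (yb - w) - (F i (x, yb) - F i (x, w))\<bar> \<le> 0 * norm (yb - w))"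
    proof (intro always_eventually allI conjI ballI)
      fix w i assume i: "i \<in> B"
      have "G i (x, w) \<bullet> (yb - w) \<le> F i (x, yb) - F i (x, w)"
        using convex_on_gradient_le[OF _ der[of i x w], of yb] i B(1) cvx by auto
      then show "G i (x, w) \<bullet> (yb - w) \<le> F i (x, yb) - F i (x, w) + 0 * norm (yb - w)" by simp
    next
      fix w i assume i: "i \<in> E"
      then have a: "affine_fun (\<lambda>y. F i (x, y))" using aff by blast
      have d: "((\<lambda>y. F i (x, y)) has_derivative (\<lambda>d. G i (x, w) \<bullet> d)) (at w)"
        using i by (intro der) auto
      have "((\<lambda>y. - F i (x, y)) has_derivative (\<lambda>d. (- G i (x, w)) \<bullet> d)) (at w)"
        using has_derivative_minus[OF d] by simp
      from convex_on_gradient_le[OF affine_fun_imp_convex_on(1)[OF a] d, of yb]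
        convex_on_gradient_le[OF affine_fun_imp_convex_on(2)[OF a] this, of yb]
      show "\<bar>G i (x, w) \<bullet> (yb - w) - (F i (x, yb) - F i (x, w))\<bar> \<le> 0 * norm (yb - w)"
        by simp
    qed
  next
    fix i assume "i \<in> B"
    then have "max 0 (F i (x, yb) - c i x) \<le> (\<Sum>i\<in>A. max 0 (F i (x, yb) - c i x))"
      using B(1) finite_A by (intro member_le_sum) auto
    then show "F i (x, yb) - c i x \<le> R x" using R0 unfolding R_def by linarith
  next
    fix i assume "i \<in> E"
    then have "\<bar>F i (x, yb) - c i x\<bar> \<le> (\<Sum>i\<in>E. \<bar>F i (x, yb) - c i x\<bar>)"
      using finite_E by (intro member_le_sum) auto
    then show "\<bar>F i (x, yb) - c i x\<bar> \<le> R x" using R0 unfolding R_def by linarith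
  next
    show "0 \<le> R x" using R0 by (simp add: R_def)
    show "z \<in> feas x" unfolding x_def z_def by (rule Zr)
    show "dist yb z \<le> dist yb w" if "w \<in> feas x" for w
      using proj[of "r n"] that by (simp add: x_def z_def)
  qed (use n in \<open>simp_all add: x_def z_def\<close>)
  then have "norm (yb - z) < e" using n(1) by (simp add: x_def)
  moreover have "e \<le> dist z yb" using X(4)[of z "r n"] Zr[of n] by (simp add: z_def)
  ultimately show False by (simp add: dist_norm norm_minus_commute)
qed

text \<open>A point \<open>y\<close> feasible for \<open>x\<close> violates the system at
  \<open>x'\<close> by at most a Lipschitz constant times the distance of the parameters; the error
  bound at \<open>(x', y)\<close> turns this into a distance to \<open>feas x'\<close>.\<close>

lemma error_bound_imp_aubin:
  assumes eb: "\<forall>\<^sub>F z in nhds (xb, yb). \<forall>r\<ge>0. (\<forall>i\<in>A. F i z - c i (fst z) \<le> r) \<longrightarrow>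
       (\<forall>i\<in>E. \<bar>F i z - c i (fst z)\<bar> \<le> r) \<longrightarrow> (\<exists>w\<in>feas (fst z). dist (snd z) w \<le> \<kappa> * r)"
    and lipF: "\<forall>i\<in>A \<union> E. \<exists>\<rho>>0. \<exists>L. L-lipschitz_on (ball (xb, yb) \<rho>) (F i)"
    and lipc: "\<forall>i\<in>A \<union> E. \<exists>\<rho>>0. \<exists>L. L-lipschitz_on (ball xb \<rho>) (c i)"
  shows "\<exists>\<rho>>0. \<exists>K. \<forall>x\<in>ball xb \<rho>. \<forall>x'\<in>ball xb \<rho>. \<forall>y\<in>feas x \<inter> ball yb \<rho>.
    \<exists>z\<in>feas x'. norm (y - z) \<le> K * norm (x - x')"
proof -
  obtain \<rho>1 where \<rho>1: "\<rho>1 > 0" and eb1: "\<And>x y r. dist x xb < \<rho>1 \<Longrightarrow> dist y yb < \<rho>1 \<Longrightarrow> r \<ge> 0 \<Longrightarrow>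
      (\<forall>i\<in>A. F i (x, y) - c i x \<le> r) \<Longrightarrow> (\<forall>i\<in>E. \<bar>F i (x, y) - c i x\<bar> \<le> r) \<Longrightarrow>
      \<exists>w\<in>feas x. dist y w \<le> \<kappa> * r"
    using eb unfolding eventually_nhds_Pair_iff_box by auto
  obtain \<rho>2 L where \<rho>2: "\<rho>2 > 0" and L: "\<And>i. i \<in> A \<union> E \<Longrightarrow> L-lipschitz_on (ball (xb, yb) \<rho>2) (F i)"
    using locally_lipschitz_family[OF _ lipF] finite_A finite_E by auto
  obtain \<rho>3 L' where \<rho>3: "\<rho>3 > 0" and L': "\<And>i. i \<in> A \<union> E \<Longrightarrow> L'-lipschitz_on (ball xb \<rho>3) (c i)"
    using locally_lipschitz_family[OF _ lipc] finite_A finite_E by auto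
  define \<rho> where "\<rho> = min \<rho>1 (min (\<rho>2/2) \<rho>3)"
  have \<rho>: "\<rho> > 0" "\<rho> \<le> \<rho>1" "\<rho> \<le> \<rho>2/2" "\<rho> \<le> \<rho>3" using \<rho>1 \<rho>2 \<rho>3 by (auto simp: \<rho>_def)
  \<comment> \<open>For an empty index set the two Lipschitz constants are arbitrary reals, so the
    sum is cut off at 0.\<close>
  define N where "N = max 0 (L + L')"
  have inball: "(x, y) \<in> ball (xb, yb) \<rho>2" if "dist x xb < \<rho>" "dist y yb < \<rho>" for x y
  proof -
    have "dist (xb, yb) (x, y) \<le> dist xb x + dist yb y"
      unfolding dist_Pair_Pair by (rule sqrt_sum_squares_le_sum) auto
    then show ?thesis using that \<rho> by (simp add: dist_commute)
  qed
  have "\<exists>z\<in>feas x'. norm (y - z) \<le> (\<kappa> * N) * norm (x - x')"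
    if x: "dist x xb < \<rho>" and x': "dist x' xb < \<rho>" and y: "y \<in> feas x" "dist y yb < \<rho>" for x x' y
  proof -
    have dF: "\<bar>(F i (x', y) - c i x') - (F i (x, y) - c i x)\<bar> \<le> N * dist x x'" if i: "i \<in> A \<union> E" for i
    proof -
      have "\<bar>F i (x', y) - F i (x, y)\<bar> \<le> L * dist x x'"
        using lipschitz_onD[OF L[OF i] inball[OF x' y(2)] inball[OF x y(2)]]
        by (simp add: dist_Pair_Pair dist_real_def dist_commute)
      moreover have "\<bar>c i x' - c i x\<bar> \<le> L' * dist x x'"
        using lipschitz_onD[OF L'[OF i], of x' x] x x' \<rho> by (simp add: dist_real_def dist_commute)
      moreover have "L * dist x x' + L' * dist x x' \<le> N * dist x x'"
        unfolding distrib_right[symmetric] by (intro mult_right_mono) (auto simp: N_def)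
      ultimately show ?thesis by linarith
    qed
    have "\<exists>w\<in>feas x'. dist y w \<le> \<kappa> * (N * dist x x')"
    proof (rule eb1)
      show "dist x' xb < \<rho>1" "dist y yb < \<rho>1" using x' y \<rho> by auto
      show "0 \<le> N * dist x x'" by (simp add: N_def)
      show "\<forall>i\<in>A. F i (x', y) - c i x' \<le> N * dist x x'"
      proof
        fix i assume i: "i \<in> A"
        then have "F i (x, y) \<le> c i x" using y by (simp add: feas_def)
        with dF[of i] i show "F i (x', y) - c i x' \<le> N * dist x x'" by auto
      qed
      show "\<forall>i\<in>E. \<bar>F i (x', y) - c i x'\<bar> \<le> N * dist x x'"
      proof
        fix i assume i: "i \<in> E"
        then have "F i (x, y) = c i x" using y by (simp add: feas_def)
        with dF[of i] i show "\<bar>F i (x', y) - c i x'\<bar> \<le> N * dist x x'" by auto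
      qed
    qed
    then show ?thesis by (simp add: dist_norm mult.assoc)
  qed
  then have "\<forall>x\<in>ball xb \<rho>. \<forall>x'\<in>ball xb \<rho>. \<forall>y\<in>feas x \<inter> ball yb \<rho>.
    \<exists>z\<in>feas x'. norm (y - z) \<le> (\<kappa> * N) * norm (x - x')"
    by (auto simp: dist_commute)
  with \<rho>(1) show ?thesis by blast
qed

end

section \<open>The solution map of a parametric program\<close>

lemma C1_fun_imp_continuous_on: "C1_fun g \<Longrightarrow> continuous_on S g"
  unfolding C1_fun_def
  by (meson continuous_at_imp_continuous_on has_derivative_continuous)

text \<open>Identifies \<open>grad_y g z\<close> as the Riesz representative of the derivative
  restricted to y-directions.\<close>

lemma grad_y_inner:
  assumes "(g has_derivative g') (at z)"
  shows "grad_y g z \<bullet> d = g' (0, d)"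
proof -
  have fd: "frechet_derivative g (at z) = g'"
    by (rule frechet_derivative_at[OF assms, symmetric])
  interpret bounded_linear g' by (rule has_derivative_bounded_linear[OF assms])
  have "g' (0, d) = g' (0, \<Sum>b\<in>Basis. (d \<bullet> b) *\<^sub>R b)" by (simp add: euclidean_representation)
  also have "(0, \<Sum>b\<in>Basis. (d \<bullet> b) *\<^sub>R b) = (\<Sum>b\<in>Basis. (d \<bullet> b) *\<^sub>R (0, b))"
    by (simp add: prod_eq_iff fst_sum snd_sum)
  also have "g' \<dots> = (\<Sum>b\<in>Basis. (d \<bullet> b) * g' (0, b))"
    by (simp add: sum scaleR del: scaleR_Pair)
  finally show ?thesis
    unfolding grad_y_def fd inner_sum_left inner_scaleR_left by (simp add: inner_commute mult.commute)
qed

lemma C1_fun_partial_derivative: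
  assumes "C1_fun g"
  shows "((\<lambda>y. g (x, y)) has_derivative (\<lambda>d. grad_y g (x, y) \<bullet> d)) (at y)"
proof -
  obtain g' where g': "\<And>z. (g has_derivative blinfun_apply (g' z)) (at z)"
    using assms unfolding C1_fun_def by blast
  have "((\<lambda>y. (x, y)) has_derivative (\<lambda>d. (0, d))) (at y)"
    by (auto intro!: derivative_eq_intros)
  from has_derivative_compose[OF this g'] show ?thesis
    by (simp add: grad_y_inner[OF g'])
qed

lemma C1_fun_continuous_on_grad_y:
  assumes "C1_fun g"
  shows "continuous_on UNIV (grad_y g)"
proof -
  obtain g' where g': "\<And>z. (g has_derivative blinfun_apply (g' z)) (at z)"
    and c: "continuous_on UNIV g'"
    using assms unfolding C1_fun_def by blast
  have "grad_y g = (\<lambda>z. \<Sum>b\<in>Basis. blinfun_apply (g' z) (0, b) *\<^sub>R b)"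
    unfolding grad_y_def using frechet_derivative_at[OF g'] by (auto simp: fun_eq_iff)
  then show ?thesis by (simp only:) (intro continuous_intros c)
qed

lemma C1_fun_locally_lipschitz:
  assumes "C1_fun g"
  shows "\<exists>\<rho>>0. \<exists>L. L-lipschitz_on (ball z \<rho>) g"
proof -
  obtain g' where g': "\<And>z. (g has_derivative blinfun_apply (g' z)) (at z)"
    and c: "continuous_on UNIV g'"
    using assms unfolding C1_fun_def by blast
  have "isCont g' z" using c by (simp add: continuous_on_eq_continuous_at)
  then obtain \<rho> where \<rho>: "\<rho> > 0" "\<And>u. dist u z < \<rho> \<Longrightarrow> dist (g' u) (g' z) < 1"
    unfolding continuous_at_eps_delta by (metis zero_less_one)
  have "(norm (g' z) + 1)-lipschitz_on (ball z \<rho>) g"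
  proof (rule bounded_derivative_imp_lipschitz)
    fix u assume "u \<in> ball z \<rho>"
    then have "norm (g' u - g' z) < 1" using \<rho>(2)[of u] by (simp add: dist_norm norm_minus_commute)
    then have "norm (g' u) \<le> norm (g' z) + 1"
      using norm_triangle_sub[of "g' u" "g' z"] by linarith
    then show "onorm (blinfun_apply (g' u)) \<le> norm (g' z) + 1" by (simp add: norm_blinfun.rep_eq)
  qed (auto intro: has_derivative_at_withinI g')
  with \<rho> show ?thesis by blast
qed

section \<open>Solutions as points of a constraint system\<close>

lemma Sol_subset_Gam: "Sol f h l p x \<subseteq> Gam h l p x"
  by (auto simp: Sol_def)

lemma phi_eq_if_Sol:
  assumes "y \<in> Sol f h l p x"
  shows "phi f h l p x = ereal (f (x, y))"
  unfolding phi_def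
proof (rule antisym)
  show "(INF y\<in>Gam h l p x. ereal (f (x, y))) \<le> ereal (f (x, y))"
    using assms by (intro INF_lower) (auto simp: Sol_def)
  show "ereal (f (x, y)) \<le> (INF y\<in>Gam h l p x. ereal (f (x, y)))"
    using assms by (intro INF_greatest) (auto simp: Sol_def)
qed

text \<open>Constraints are numbered from 1, so slot 0 is free for the objective; this matches the
  convention of \<open>gy\<close>.\<close>

definition with_objective :: "('c \<Rightarrow> real) \<Rightarrow> (nat \<Rightarrow> 'c \<Rightarrow> real) \<Rightarrow> nat \<Rightarrow> 'c \<Rightarrow> real" where
  "with_objective f h i = (if i = 0 then f else h i)"

text \<open>Right-hand side of the system defining \<^const>\<open>Sol\<close>; the coercion turns infinite values
  into \<open>0\<close>, so it is meaningful only where \<^const>\<open>Sol\<close> is nonempty.\<close>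

definition value_rhs :: "('a \<times> 'b \<Rightarrow> real) \<Rightarrow> (nat \<Rightarrow> 'a \<times> 'b \<Rightarrow> real) \<Rightarrow> nat \<Rightarrow> nat \<Rightarrow> nat \<Rightarrow> 'a \<Rightarrow> real" where
  "value_rhs f h l p i x = (if i = 0 then real_of_ereal (phi f h l p x) else 0)"

locale parametric_program =
  fixes f :: "'a::euclidean_space \<times> 'b::euclidean_space \<Rightarrow> real"
    and h :: "nat \<Rightarrow> 'a \<times> 'b \<Rightarrow> real" and l p :: nat
  assumes l_le_p: "l \<le> p" and C1_f: "C1_fun f" and C1_h: "\<And>i. i \<in> {1..p} \<Longrightarrow> C1_fun (h i)"
begin

lemma C1_with_objective: "i \<le> p \<Longrightarrow> C1_fun (with_objective f h i)"
  using C1_f C1_h by (auto simp: with_objective_def)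

lemma gy_eq_grad_y: "gy f h i = grad_y (with_objective f h i)"
  by (auto simp: gy_def with_objective_def fun_eq_iff)

text \<open>The right-hand side does not occur in the locale predicate, so this covers both the
  feasible set (right-hand side 0) and the solution set (right-hand side phi).\<close>

lemma parametric_system_subset:
  assumes "A \<subseteq> {0..l}"
  shows "parametric_system (with_objective f h) (gy f h) A {l+1..p}"
proof
  show "finite A" using assms finite_subset by blast
  show "A \<inter> {l+1..p} = {}" using assms by auto
  fix i assume "i \<in> A \<union> {l+1..p}"
  then have "C1_fun (with_objective f h i)" using assms l_le_p by (intro C1_with_objective) auto
  then show "((\<lambda>y. with_objective f h i (x, y)) has_derivative (\<lambda>d. gy f h i (x, y) \<bullet> d)) (at y)"
    "continuous_on UNIV (with_objective f h i)" "continuous_on UNIV (gy f h i)" for x y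
    unfolding gy_eq_grad_y
    by (rule C1_fun_partial_derivative C1_fun_imp_continuous_on C1_fun_continuous_on_grad_y)+
qed simp

sublocale Gam_system: parametric_system "with_objective f h" "gy f h" "\<lambda>_ _. 0" "{1..l}" "{l+1..p}"
  by (rule parametric_system_subset) auto

sublocale Sol_system: parametric_system "with_objective f h" "gy f h" "value_rhs f h l p" "{0..l}" "{l+1..p}"
  by (rule parametric_system_subset) auto

lemma Gam_eq_feas: "Gam h l p = Gam_system.feas"
  unfolding fun_eq_iff Gam_def Gam_system.feas_def by (auto simp: with_objective_def)

text \<open>A solution attains the value, which is then finite, so the real coercion in
  \<open>value_rhs\<close> is faithful.\<close>

lemma Sol_eq_feas:
  assumes "Sol f h l p x \<noteq> {}"
  shows "Sol f h l p x = Sol_system.feas x"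
proof -
  obtain y0 where y0: "y0 \<in> Sol f h l p x" using assms by blast
  have "y \<in> Sol f h l p x \<longleftrightarrow> y \<in> Gam h l p x \<and> f (x, y) \<le> f (x, y0)" for y
    using y0 unfolding Sol_def by force
  moreover have "y \<in> Sol_system.feas x \<longleftrightarrow> y \<in> Gam h l p x \<and> f (x, y) \<le> f (x, y0)" for y
  proof -
    have "{0..l} = insert 0 {1..l}" by auto
    then show ?thesis
      unfolding Sol_system.feas_def Gam_def mem_Collect_eq
      by (auto simp: with_objective_def value_rhs_def phi_eq_if_Sol[OF y0])
  qed
  ultimately show ?thesis by blast
qed

lemma inactive_eventually:
  assumes "i \<in> {1..l}" "h i z < 0"
  shows "\<forall>\<^sub>F w in nhds z. with_objective f h i w \<le> 0"
proof -
  have "continuous_on UNIV (h i)" using assms l_le_p by (intro C1_fun_imp_continuous_on C1_h) auto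
  then have "(h i \<longlongrightarrow> h i z) (nhds z)"
    unfolding continuous_on_eq_continuous_at[OF open_UNIV] continuous_at tendsto_at_iff_tendsto_nhds
    by blast
  from order_tendstoD(2)[OF this assms(2)] show ?thesis
    using assms(1) by (auto simp: with_objective_def elim!: eventually_mono)
qed

text \<open>Strict inequalities persist by continuity. Index 0 is always kept among the active ones,
  since at a solution f equals the optimal value.\<close>

lemma active_set:
  assumes "yb \<in> Gam h l p xb"
  defines "B \<equiv> {i\<in>{1..l}. h i (xb, yb) = 0}"
  shows "\<forall>i\<in>{1..l} - B. \<forall>\<^sub>F w in nhds (xb, yb). with_objective f h i w \<le> 0"
    and "\<forall>i\<in>{0..l} - ({0} \<union> B). \<forall>\<^sub>F w in nhds (xb, yb). with_objective f h i w \<le> value_rhs f h l p i (fst w)"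
proof -
  show 1: "\<forall>i\<in>{1..l} - B. \<forall>\<^sub>F w in nhds (xb, yb). with_objective f h i w \<le> 0"
  proof
    fix i assume i: "i \<in> {1..l} - B"
    then have "h i (xb, yb) < 0" using assms by (auto simp: Gam_def less_le)
    then show "\<forall>\<^sub>F w in nhds (xb, yb). with_objective f h i w \<le> 0"
      using i by (intro inactive_eventually) auto
  qed
  have "{0..l} - ({0} \<union> B) = {1..l} - B" by auto
  then show "\<forall>i\<in>{0..l} - ({0} \<union> B). \<forall>\<^sub>F w in nhds (xb, yb). with_objective f h i w \<le> value_rhs f h l p i (fst w)"
    using 1 by (auto simp: value_rhs_def)
qed

text \<open>Take a solution for \<open>x'\<close> close to \<open>yb\<close>, which inner
  semicontinuity provides, and move it into the feasible set of \<open>x\<close> by the Aubin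
  property. The resulting point bounds phi at \<open>x\<close> from above, and exchanging the
  parameters gives the reverse estimate.\<close>

lemma locally_lipschitz_value:
  assumes isc: "\<And>e. e > 0 \<Longrightarrow> \<forall>\<^sub>F x in nhds xb. \<exists>y\<in>Sol f h l p x. dist y yb < e"
    and aub: "\<exists>\<rho>>0. \<exists>K. \<forall>x\<in>ball xb \<rho>. \<forall>x'\<in>ball xb \<rho>. \<forall>y\<in>Gam h l p x \<inter> ball yb \<rho>.
      \<exists>z\<in>Gam h l p x'. norm (y - z) \<le> K * norm (x - x')"
  shows "\<exists>\<rho>>0. \<exists>L. L-lipschitz_on (ball xb \<rho>) (\<lambda>x. real_of_ereal (phi f h l p x))"
proof -
  obtain \<rho>1 K0 where \<rho>1: "\<rho>1 > 0" and aub0: "\<And>x x' y. x \<in> ball xb \<rho>1 \<Longrightarrow> x' \<in> ball xb \<rho>1 \<Longrightarrow>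
      y \<in> Gam h l p x \<inter> ball yb \<rho>1 \<Longrightarrow> \<exists>z\<in>Gam h l p x'. norm (y - z) \<le> K0 * norm (x - x')"
    using aub by blast
  define K where "K = max 0 K0"
  have K: "K \<ge> 0" by (simp add: K_def)
  have aub1: "\<exists>z\<in>Gam h l p x'. norm (y - z) \<le> K * norm (x - x')"
    if "x \<in> ball xb \<rho>1" "x' \<in> ball xb \<rho>1" "y \<in> Gam h l p x \<inter> ball yb \<rho>1" for x x' y
  proof -
    have "\<exists>z\<in>Gam h l p x'. norm (y - z) \<le> K0 * norm (x - x')" by (rule aub0[OF that])
    then obtain z where "z \<in> Gam h l p x'" "norm (y - z) \<le> K0 * norm (x - x')" by blast
    moreover have "K0 * norm (x - x') \<le> K * norm (x - x')" by (intro mult_right_mono) (auto simp: K_def)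
    ultimately show ?thesis by (meson order_trans)
  qed
  obtain \<rho>2 L where \<rho>2: "\<rho>2 > 0" and L: "L-lipschitz_on (ball (xb, yb) \<rho>2) f"
    using C1_fun_locally_lipschitz[OF C1_f] by blast
  have L0: "L \<ge> 0" using L by (rule lipschitz_on_nonneg)
  define e where "e = min \<rho>1 (\<rho>2 / 4)"
  have e: "e > 0" using \<rho>1 \<rho>2 by (simp add: e_def)
  obtain \<rho>3 where \<rho>3: "\<rho>3 > 0" and near: "\<And>x. dist x xb < \<rho>3 \<Longrightarrow> \<exists>y\<in>Sol f h l p x. dist y yb < e"
    using isc[OF e] unfolding eventually_nhds_metric by blast
  \<comment> \<open>Two parameters in the ball are less than \<open>2 * \<rho>\<close> apart, so the
    transfer moves \<open>y\<close> by at most a quarter of \<open>\<rho>2\<close>, and both pairs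
    stay where f is Lipschitz.\<close>
  define \<rho> where "\<rho> = min (min \<rho>1 \<rho>3) (\<rho>2 / (8 * (K + 1)))"
  have \<rho>: "\<rho> > 0" "\<rho> \<le> \<rho>1" "\<rho> \<le> \<rho>3" "\<rho> \<le> \<rho>2 / (8 * (K + 1))"
    using \<rho>1 \<rho>2 \<rho>3 K by (auto simp: \<rho>_def)
  have K\<rho>: "(K + 1) * (2 * \<rho>) \<le> \<rho>2 / 4" using \<rho>(4) K by (simp add: field_simps)
  let ?v = "\<lambda>x. real_of_ereal (phi f h l p x)"
  have le: "?v x \<le> ?v x' + L * (K + 1) * dist x x'" if x: "dist x xb < \<rho>" and x': "dist x' xb < \<rho>" for x x'
  proof -
    obtain u where u: "u \<in> Sol f h l p x" using near[of x] x \<rho> by auto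
    obtain y where y: "y \<in> Sol f h l p x'" "dist y yb < e" using near[of x'] x' \<rho> by auto
    have "\<exists>z\<in>Gam h l p x. norm (y - z) \<le> K * norm (x' - x)"
    proof (rule aub1)
      show "y \<in> Gam h l p x' \<inter> ball yb \<rho>1"
        using y Sol_subset_Gam[of f h l p x'] by (auto simp: e_def dist_commute)
    qed (use x x' \<rho> in \<open>auto simp: dist_commute\<close>)
    then obtain z where z: "z \<in> Gam h l p x" "dist y z \<le> K * dist x x'"
      by (auto simp: dist_norm norm_minus_commute)
    have "dist x x' \<le> dist x xb + dist x' xb" by (rule dist_triangle2)
    then have dxx: "dist x x' \<le> 2 * \<rho>" using x x' by linarith
    have "K * dist x x' \<le> K * (2 * \<rho>)" using dxx K by (rule mult_left_mono)
    then have dyz: "dist y z \<le> \<rho>2 / 4" "\<rho> \<le> \<rho>2 / 4" using z K\<rho> \<rho>(1) K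
      by (auto simp: algebra_simps) (smt (verit) mult_nonneg_nonneg)+
    have 1: "(x', y) \<in> ball (xb, yb) \<rho>2"
    proof -
      have "dist (xb, yb) (x', y) \<le> dist xb x' + dist yb y"
        unfolding dist_Pair_Pair by (rule sqrt_sum_squares_le_sum) auto
      then show ?thesis using x' y dyz \<rho>2 by (auto simp: e_def dist_commute)
    qed
    have 2: "(x, z) \<in> ball (xb, yb) \<rho>2"
    proof -
      have "dist (xb, yb) (x, z) \<le> dist xb x + dist yb z"
        unfolding dist_Pair_Pair by (rule sqrt_sum_squares_le_sum) auto
      moreover have "dist yb z \<le> dist yb y + dist y z" by (rule dist_triangle)
      ultimately show ?thesis using x y dyz \<rho>2 by (auto simp: e_def dist_commute)
    qed
    have "?v x = f (x, u)" using phi_eq_if_Sol[OF u] by simp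
    also have "f (x, u) \<le> f (x, z)" using u z by (auto simp: Sol_def)
    also have "f (x, z) \<le> f (x', y) + L * dist (x, z) (x', y)"
      using lipschitz_onD[OF L 2 1] by (simp add: dist_real_def)
    also have "f (x', y) = ?v x'" using phi_eq_if_Sol[OF y(1)] by simp
    also have "dist (x, z) (x', y) \<le> dist x x' + dist z y"
      unfolding dist_Pair_Pair by (rule sqrt_sum_squares_le_sum) auto
    also have "dist x x' + dist z y \<le> (K + 1) * dist x x'"
      using z by (simp add: algebra_simps dist_commute)
    finally show ?thesis using L0 by (simp add: mult_left_mono mult.assoc)
  qed
  have "(L * (K + 1))-lipschitz_on (ball xb \<rho>) ?v"
  proof (rule lipschitz_onI)
    fix x x' assume "x \<in> ball xb \<rho>" "x' \<in> ball xb \<rho>"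
    then show "dist (?v x) (?v x') \<le> L * (K + 1) * dist x x'"
      using le[of x x'] le[of x' x] by (auto simp: dist_real_def dist_commute abs_le_iff)
  qed (use L0 K in simp)
  with \<rho>(1) show ?thesis by blast
qed

text \<open>Near \<open>xb\<close> solutions exist, so the extended-real residual is a real number,
  and it is itself an admissible \<open>r\<close> in the error bound.\<close>

lemma error_bound_imp_R_regular:
  assumes ne: "\<forall>\<^sub>F x in nhds xb. Sol f h l p x \<noteq> {}" and \<kappa>: "\<kappa> > 0"
    and eb: "\<forall>\<^sub>F z in nhds (xb, yb). \<forall>r\<ge>0.
       (\<forall>i\<in>{0..l}. with_objective f h i z - value_rhs f h l p i (fst z) \<le> r) \<longrightarrow>
       (\<forall>i\<in>{l+1..p}. \<bar>with_objective f h i z - value_rhs f h l p i (fst z)\<bar> \<le> r) \<longrightarrow>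
       (\<exists>w\<in>Sol_system.feas (fst z). dist (snd z) w \<le> \<kappa> * r)"
  shows "R_regular_S f h l p xb yb"
proof -
  obtain V where V: "open V" "xb \<in> V" "\<And>x. x \<in> V \<Longrightarrow> Sol f h l p x \<noteq> {}"
    using ne unfolding eventually_nhds by blast
  obtain W where W: "open W" "(xb, yb) \<in> W" and ebW: "\<And>z r. z \<in> W \<Longrightarrow> r \<ge> 0 \<Longrightarrow>
       (\<forall>i\<in>{0..l}. with_objective f h i z - value_rhs f h l p i (fst z) \<le> r) \<Longrightarrow>
       (\<forall>i\<in>{l+1..p}. \<bar>with_objective f h i z - value_rhs f h l p i (fst z)\<bar> \<le> r) \<Longrightarrow>
       (\<exists>w\<in>Sol_system.feas (fst z). dist (snd z) w \<le> \<kappa> * r)"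
    using eb unfolding eventually_nhds by blast
  have "edist_set y (Sol f h l p x) \<le> ereal \<kappa> * residual f h l p (x, y)"
    if xy: "(x, y) \<in> W" "x \<in> V" for x y
  proof -
    obtain u where u: "u \<in> Sol f h l p x" using V xy by blast
    let ?T = "{0, h0 f h l p (x, y)} \<union> (\<lambda>i. ereal (h i (x, y))) ` {1..l}
                                \<union> (\<lambda>i. ereal \<bar>h i (x, y)\<bar>) ` {l+1..p}"
    have h0: "h0 f h l p (x, y) = ereal (f (x, y) - f (x, u))"
      by (simp add: h0_def phi_eq_if_Sol[OF u])
    have fin: "finite ?T" by simp
    have res: "residual f h l p (x, y) = Max ?T" by (simp only: residual_def)
    have "Max ?T \<in> ?T" using fin by (intro Max_in) auto
    \<comment> \<open>The maximum belongs to the finite set, whose members are all real once phi is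
      attained.\<close>
    then obtain r where r: "Max ?T = ereal r" unfolding h0 zero_ereal_def by blast
    have le: "t \<le> ereal r" if "t \<in> ?T" for t using Max_ge[OF fin that] r by simp
    have "0 \<le> ereal r" by (rule le) simp
    then have r0: "0 \<le> r" by simp
    have "ereal (f (x, y) - f (x, u)) \<le> ereal r" unfolding h0[symmetric] by (rule le) simp
    then have rf: "f (x, y) - f (x, u) \<le> r" by simp
    have rh: "h i (x, y) \<le> r" if "i \<in> {1..l}" for i using le[of "ereal (h i (x, y))"] that by auto
    have rE: "\<bar>h i (x, y)\<bar> \<le> r" if "i \<in> {l+1..p}" for i using le[of "ereal \<bar>h i (x, y)\<bar>"] that by auto
    have "\<exists>w\<in>Sol_system.feas (fst (x, y)). dist (snd (x, y)) w \<le> \<kappa> * r"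
    proof (rule ebW[OF xy(1) r0])
      show "\<forall>i\<in>{0..l}. with_objective f h i (x, y) - value_rhs f h l p i (fst (x, y)) \<le> r"
        using rf rh by (auto simp: with_objective_def value_rhs_def phi_eq_if_Sol[OF u])
      show "\<forall>i\<in>{l+1..p}. \<bar>with_objective f h i (x, y) - value_rhs f h l p i (fst (x, y))\<bar> \<le> r"
        using rE by (auto simp: with_objective_def value_rhs_def)
    qed
    then obtain w where w: "w \<in> Sol f h l p x" "dist y w \<le> \<kappa> * r"
      using Sol_eq_feas[OF V(3)[OF xy(2)]] by auto
    have "infdist y (Sol f h l p x) \<le> \<kappa> * r"
      using infdist_le[OF w(1), of y] w(2) by linarith
    then show ?thesis unfolding res r edist_set_def using w(1) by auto
  qed
  then show ?thesis unfolding R_regular_S_def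
    using \<kappa> V W by (intro exI[of _ \<kappa>] conjI exI[of _ "W \<inter> (V \<times> UNIV)"]) (auto intro!: open_Int open_Times)
qed

text \<open>The error bound is used with active set \<open>B\<close> for the feasible set and with
  \<open>{0} \<union> B\<close> for the solution set. The first makes phi Lipschitz, as the passage
  from the second to the Aubin property demands.\<close>

lemma regular_if_inner_semicontinuous:
  assumes yb: "yb \<in> Sol f h l p xb" and rc: "RCPLD_S f h l p xb yb"
    and isc: "\<And>e. e > 0 \<Longrightarrow> \<forall>\<^sub>F x in nhds xb. \<exists>y\<in>Sol f h l p x. dist y yb < e"
  shows "R_regular_S f h l p xb yb" "aubin (Sol f h l p) xb yb"
proof -
  define B where "B = {i\<in>{1..l}. h i (xb, yb) = 0}"
  have ybG: "yb \<in> Gam h l p xb" by (rule subsetD[OF Sol_subset_Gam yb])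
  note inact = active_set[OF ybG, folded B_def]
  have rcS: "rcpld (gy f h) ({0} \<union> B) {l+1..p} (xb, yb)"
    using rc unfolding RCPLD_S_iff_rcpld B_def .
  then have rcG: "rcpld (gy f h) B {l+1..p} (xb, yb)" by (rule rcpld_subset) auto
  have ne: "\<forall>\<^sub>F x in nhds xb. Sol f h l p x \<noteq> {}"
    by (rule eventually_mono[OF isc[OF zero_less_one]]) auto
  have iscG: "\<forall>\<^sub>F x in nhds xb. \<exists>y\<in>Gam_system.feas x. dist y yb < e" if "e > 0" for e
    by (rule eventually_mono[OF isc[OF that]]) (use Sol_subset_Gam[of f h l p] Gam_eq_feas in auto)
  have iscS: "\<forall>\<^sub>F x in nhds xb. \<exists>y\<in>Sol_system.feas x. dist y yb < e" if "e > 0" for e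
    by (rule eventually_mono[OF eventually_conj[OF ne isc[OF that]]]) (use Sol_eq_feas in auto)
  have lipF: "\<exists>\<rho>>0. \<exists>L. L-lipschitz_on (ball (xb, yb) \<rho>) (with_objective f h i)"
    if "i \<le> p" for i
    by (intro C1_fun_locally_lipschitz C1_with_objective that)
  have BG: "B \<subseteq> {1..l}" and BS: "{0} \<union> B \<subseteq> {0..l}" unfolding B_def by auto
  have const: "\<exists>\<rho>>0. \<exists>L. L-lipschitz_on (ball xb \<rho>) (\<lambda>_. 0::real)"
    by (intro exI[of _ 1] conjI exI[of _ 0]) (auto intro: lipschitz_on_constant)
  obtain \<kappa>G where ebG: "\<forall>\<^sub>F z in nhds (xb, yb). \<forall>r\<ge>0. (\<forall>i\<in>{1..l}. with_objective f h i z - 0 \<le> r) \<longrightarrow>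
       (\<forall>i\<in>{l+1..p}. \<bar>with_objective f h i z - 0\<bar> \<le> r) \<longrightarrow> (\<exists>w\<in>Gam_system.feas (fst z). dist (snd z) w \<le> \<kappa>G * r)"
    by (rule Gam_system.error_bound[OF BG rcG inact(1) iscG])
  have "\<exists>\<rho>>0. \<exists>K. \<forall>x\<in>ball xb \<rho>. \<forall>x'\<in>ball xb \<rho>. \<forall>y\<in>Gam h l p x \<inter> ball yb \<rho>.
      \<exists>z\<in>Gam h l p x'. norm (y - z) \<le> K * norm (x - x')"
    unfolding Gam_eq_feas
    by (rule Gam_system.error_bound_imp_aubin[OF ebG]) (use lipF const l_le_p in auto)
  note lipv = locally_lipschitz_value[OF isc this]
  obtain \<kappa> where \<kappa>: "\<kappa> > 0" and eb: "\<forall>\<^sub>F z in nhds (xb, yb). \<forall>r\<ge>0.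
       (\<forall>i\<in>{0..l}. with_objective f h i z - value_rhs f h l p i (fst z) \<le> r) \<longrightarrow>
       (\<forall>i\<in>{l+1..p}. \<bar>with_objective f h i z - value_rhs f h l p i (fst z)\<bar> \<le> r) \<longrightarrow>
       (\<exists>w\<in>Sol_system.feas (fst z). dist (snd z) w \<le> \<kappa> * r)"
    by (rule Sol_system.error_bound[OF BS rcS inact(2) iscS])
  show "R_regular_S f h l p xb yb" by (rule error_bound_imp_R_regular[OF ne \<kappa> eb])
  have lipc: "\<exists>\<rho>>0. \<exists>L. L-lipschitz_on (ball xb \<rho>) (value_rhs f h l p i)" for i
    unfolding value_rhs_def using lipv const by (cases "i = 0") auto
  have "\<exists>\<rho>>0. \<exists>K. \<forall>x\<in>ball xb \<rho>. \<forall>x'\<in>ball xb \<rho>. \<forall>y\<in>Sol_system.feas x \<inter> ball yb \<rho>.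
      \<exists>z\<in>Sol_system.feas x'. norm (y - z) \<le> K * norm (x - x')"
    by (rule Sol_system.error_bound_imp_aubin[OF eb]) (use lipF lipc l_le_p in auto)
  then obtain \<rho> K where \<rho>: "\<rho> > 0" and aub: "\<And>x x' y. x \<in> ball xb \<rho> \<Longrightarrow> x' \<in> ball xb \<rho> \<Longrightarrow>
      y \<in> Sol_system.feas x \<inter> ball yb \<rho> \<Longrightarrow> \<exists>z\<in>Sol_system.feas x'. norm (y - z) \<le> K * norm (x - x')"
    by blast
  obtain V where V: "open V" "xb \<in> V" "\<And>x. x \<in> V \<Longrightarrow> Sol f h l p x \<noteq> {}"
    using ne unfolding eventually_nhds by blast
  \<comment> \<open>Intersecting with \<open>V\<close> keeps to parameters where \<open>Sol\<close>
    and the feasible set of the system coincide; the maximum with 1 supplies the positive modulus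
    that \<open>aubin\<close> asks for.\<close>
  have "\<exists>z\<in>Sol f h l p x'. norm (y - z) \<le> max 1 K * norm (x - x')"
    if "x \<in> V \<inter> ball xb \<rho>" "x' \<in> V \<inter> ball xb \<rho>" "y \<in> Sol f h l p x \<inter> ball yb \<rho>" for x x' y
  proof -
    have "\<exists>z\<in>Sol f h l p x'. norm (y - z) \<le> K * norm (x - x')"
      using aub[of x x' y] that V(3) Sol_eq_feas[of x] Sol_eq_feas[of x'] by auto
    moreover have "K * norm (x - x') \<le> max 1 K * norm (x - x')" by (intro mult_right_mono) auto
    ultimately show ?thesis by (meson order_trans)
  qed
  then show "aubin (Sol f h l p) xb yb"
    unfolding aubin_def using V \<rho>
    by (intro exI[of _ "V \<inter> ball xb \<rho>"] exI[of _ "ball yb \<rho>"] exI[of _ "max 1 K"] conjI) auto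
qed

section \<open>Existence and inner semicontinuity of solutions in the convex case\<close>

lemma Sol_nonempty_if_compact:
  assumes "bounded (Gam h l p x)" "Gam h l p x \<noteq> {}"
  shows "Sol f h l p x \<noteq> {}"
proof -
  have "compact (Gam h l p x)"
    using assms(1) Gam_system.closed_feas by (simp only: Gam_eq_feas compact_eq_bounded_closed)
  moreover have "continuous_on (Gam h l p x) (\<lambda>y. f (x, y))"
    by (intro continuous_on_compose2[OF C1_fun_imp_continuous_on[OF C1_f, of UNIV]] continuous_intros) auto
  ultimately obtain y where "y \<in> Gam h l p x" "\<forall>y'\<in>Gam h l p x. f (x, y) \<le> f (x, y')"
    using continuous_attains_inf[OF _ assms(2)] by blast
  then show ?thesis by (auto simp: Sol_def)
qed

text \<open>Continuity of phi acts twice: it keeps phi below infinity near \<open>xb\<close>, so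
  feasible points and, by local boundedness, solutions exist; and it makes the right-hand side of
  the solution system continuous.\<close>

lemma convex_Sol_inner_semicontinuous:
  assumes cvx: "\<And>x. convex_on UNIV (\<lambda>y. f (x, y))"
      "\<And>i x. i \<in> {1..l} \<Longrightarrow> convex_on UNIV (\<lambda>y. h i (x, y))"
      "\<And>i x. i \<in> {l+1..p} \<Longrightarrow> affine_fun (\<lambda>y. h i (x, y))"
    and lb: "locally_bounded (Gam h l p) xb"
    and rc: "\<And>z. z \<in> Sol f h l p xb \<Longrightarrow> RCPLD_S f h l p xb z"
    and phi: "isCont (phi f h l p) xb" and yb: "yb \<in> Sol f h l p xb" and e: "e > 0"
  shows "\<forall>\<^sub>F x in nhds xb. \<exists>y\<in>Sol f h l p x. dist y yb < e"
proof -
  obtain S V where S: "bounded S" and V: "open V" "xb \<in> V" "\<And>x. x \<in> V \<Longrightarrow> Gam h l p x \<subseteq> S"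
    using lb unfolding locally_bounded_def by blast
  have phib: "phi f h l p xb = ereal (f (xb, yb))" by (rule phi_eq_if_Sol[OF yb])
  have lim: "(phi f h l p \<longlongrightarrow> phi f h l p xb) (nhds xb)"
    using phi by (simp add: continuous_at tendsto_at_iff_tendsto_nhds)
  have "\<forall>\<^sub>F x in nhds xb. phi f h l p x < \<infinity>"
    by (rule order_tendstoD(2)[OF lim]) (simp add: phib)
  moreover have "\<forall>\<^sub>F x in nhds xb. x \<in> V" using V by (intro eventually_nhds_in_open)
  ultimately have ne: "\<forall>\<^sub>F x in nhds xb. Sol f h l p x \<noteq> {} \<and> Sol f h l p x \<subseteq> S"
  proof eventually_elim
    case (elim x)
    then have "Gam h l p x \<noteq> {}" by (auto simp: phi_def top_ereal_def)
    then have "Sol f h l p x \<noteq> {}"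
      by (rule Sol_nonempty_if_compact[OF bounded_subset[OF S V(3)[OF elim(2)]]])
    moreover have "Sol f h l p x \<subseteq> S" by (rule order_trans[OF Sol_subset_Gam V(3)[OF elim(2)]])
    ultimately show ?case by blast
  qed
  have feas_b: "Sol_system.feas xb = Sol f h l p xb" using yb by (intro Sol_eq_feas[symmetric]) auto
  have "\<forall>\<^sub>F x in nhds xb. \<exists>y\<in>Sol_system.feas x. dist y yb < e"
  proof (rule Sol_system.convex_inner_semicontinuous)
    show "\<forall>i\<in>{0..l}. \<forall>x. convex_on UNIV (\<lambda>y. with_objective f h i (x, y))"
      using cvx(1,2) by (auto simp: with_objective_def)
    show "\<forall>i\<in>{l+1..p}. \<forall>x. affine_fun (\<lambda>y. with_objective f h i (x, y))"
      using cvx(3) by (auto simp: with_objective_def)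
    have "((\<lambda>x. real_of_ereal (phi f h l p x)) \<longlongrightarrow> f (xb, yb)) (nhds xb)"
      using lim unfolding phib by (rule lim_real_of_ereal)
    \<comment> \<open>The coercion to reals preserves the limit because phi is finite at
      \<open>xb\<close>.\<close>
    then have "isCont (\<lambda>x. real_of_ereal (phi f h l p x)) xb"
      unfolding continuous_at by (simp add: phib tendsto_mono[OF at_within_le_nhds])
    then have "isCont (value_rhs f h l p i) xb" for i
      unfolding value_rhs_def by (cases "i = 0") simp_all
    then show "\<forall>i\<in>{0..l} \<union> {l+1..p}. isCont (value_rhs f h l p i) xb" by blast
    show "bounded S" by (rule S)
    show "\<forall>\<^sub>F x in nhds xb. Sol_system.feas x \<noteq> {} \<and> Sol_system.feas x \<subseteq> S"
      by (rule eventually_mono[OF ne]) (use Sol_eq_feas in auto)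
    show "\<forall>z\<in>Sol_system.feas xb. \<exists>B\<subseteq>{0..l}. rcpld (gy f h) B {l+1..p} (xb, z) \<and>
       (\<forall>i\<in>{0..l} - B. \<forall>\<^sub>F w in nhds (xb, z). with_objective f h i w \<le> value_rhs f h l p i (fst w))"
    proof
      fix z assume "z \<in> Sol_system.feas xb"
      then have z: "z \<in> Sol f h l p xb" by (simp only: feas_b)
      let ?B = "{0} \<union> {i\<in>{1..l}. h i (xb, z) = 0}"
      have "rcpld (gy f h) ?B {l+1..p} (xb, z)"
        using rc[OF z] unfolding RCPLD_S_iff_rcpld .
      moreover have "\<forall>i\<in>{0..l} - ?B. \<forall>\<^sub>F w in nhds (xb, z).
          with_objective f h i w \<le> value_rhs f h l p i (fst w)"
        by (rule active_set(2)[OF subsetD[OF Sol_subset_Gam z]])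
      moreover have "?B \<subseteq> {0..l}" by auto
      ultimately show "\<exists>B\<subseteq>{0..l}. rcpld (gy f h) B {l+1..p} (xb, z) \<and>
       (\<forall>i\<in>{0..l} - B. \<forall>\<^sub>F w in nhds (xb, z). with_objective f h i w \<le> value_rhs f h l p i (fst w))"
        by blast
    qed
    show "yb \<in> Sol_system.feas xb" using yb by (simp only: feas_b)
  qed (rule e)
  from eventually_conj[OF ne this] show ?thesis
    by (rule eventually_mono) (use Sol_eq_feas in auto)
qed

end

text \<open>First countability turns the sequential definition into the neighbourhood form used
  throughout.\<close>

lemma inner_semicont_eventually:
  fixes F :: "'a::first_countable_topology \<Rightarrow> 'b::metric_space set"
  assumes "inner_semicont F xb yb" "e > 0"
  shows "\<forall>\<^sub>F x in nhds xb. \<exists>y\<in>F x. dist y yb < e"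
proof -
  have "\<forall>\<^sub>F x in inf (nhds xb) (principal UNIV). \<exists>y\<in>F x. dist y yb < e"
  proof (rule sequentially_imp_eventually_nhds_within, intro allI impI)
    fix xk assume "(\<forall>n. xk n \<in> UNIV) \<and> xk \<longlonglongrightarrow> xb"
    then obtain yk where yk: "yk \<longlonglongrightarrow> yb" "\<forall>\<^sub>F k in sequentially. yk k \<in> F (xk k)"
      using assms(1) unfolding inner_semicont_def by blast
    from tendstoD[OF yk(1) assms(2)] yk(2)
    show "\<forall>\<^sub>F n in sequentially. \<exists>y\<in>F (xk n). dist y yb < e"
      by eventually_elim blast
  qed
  then show ?thesis by simp
qed

theorem theorem4p8:
  fixes f :: "(real^'n::finite) \<times> (real^'m::finite) \<Rightarrow> real"
    and h :: "nat \<Rightarrow> (real^'n::finite) \<times> (real^'m::finite) \<Rightarrow> real"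
    and l p :: nat
    and xb :: "real^'n::finite"
  assumes "l \<le> p"
    and "C1_fun f"
    and "\<forall>i\<in>{1..p}. C1_fun (h i)"
    and "Gam h l p xb \<noteq> {}"
  shows "((\<forall>x. convex_on UNIV (\<lambda>y. f (x, y))
              \<and> (\<forall>i\<in>{1..l}. convex_on UNIV (\<lambda>y. h i (x, y)))
              \<and> (\<forall>i\<in>{l+1..p}. affine_fun (\<lambda>y. h i (x, y))))
          \<and> locally_bounded (Gam h l p) xb
          \<and> (\<forall>yb\<in>Sol f h l p xb. RCPLD_S f h l p xb yb)
          \<and> isCont (phi f h l p) xb
          \<longrightarrow> (\<forall>yb\<in>Sol f h l p xb. R_regular_S f h l p xb yb \<and> aubin (Sol f h l p) xb yb))
       \<and> (\<forall>yb\<in>Sol f h l p xb.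
            inner_semicont (Sol f h l p) xb yb \<and> RCPLD_S f h l p xb yb
            \<longrightarrow> R_regular_S f h l p xb yb \<and> aubin (Sol f h l p) xb yb)"
proof -
  interpret parametric_program f h l p
    by standard (use assms in auto)
  show ?thesis
  proof (intro conjI impI ballI; elim conjE)
    fix yb
    assume cvx: "\<forall>x. convex_on UNIV (\<lambda>y. f (x, y))
              \<and> (\<forall>i\<in>{1..l}. convex_on UNIV (\<lambda>y. h i (x, y)))
              \<and> (\<forall>i\<in>{l+1..p}. affine_fun (\<lambda>y. h i (x, y)))"
      and lb: "locally_bounded (Gam h l p) xb"
      and rc: "\<forall>yb\<in>Sol f h l p xb. RCPLD_S f h l p xb yb"
      and phi: "isCont (phi f h l p) xb" and yb: "yb \<in> Sol f h l p xb"
    have "\<forall>\<^sub>F x in nhds xb. \<exists>y\<in>Sol f h l p x. dist y yb < e" if "e > 0" for e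
      by (rule convex_Sol_inner_semicontinuous[OF _ _ _ lb _ phi yb that]) (use cvx rc in auto)
    with yb rc show "R_regular_S f h l p xb yb" "aubin (Sol f h l p) xb yb"
      by (auto intro: regular_if_inner_semicontinuous)
  next
    fix yb
    assume "yb \<in> Sol f h l p xb" "RCPLD_S f h l p xb yb" and isc: "inner_semicont (Sol f h l p) xb yb"
    with inner_semicont_eventually[OF isc]
    show "R_regular_S f h l p xb yb" "aubin (Sol f h l p) xb yb"
      by (auto intro: regular_if_inner_semicontinuous)
  qed
qed

end
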